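(* The branch and bound algorithm for the traveling salesman problem (the Little–Murty–Sweeney–Karel algorithm, in the form given in the context) is not a direct-type algorithm. That is, it is not true that for every $n\ge 3$ its linear separating tree $\mathcal T_n$ is a tree of direct type. Explicitly, there exist $n$, an internal node $B$ of $\mathcal T_n$, and a clique $Y\subseteq X$ of the traveling salesman problem on $n$ vertices such that $\min\{|R_B^+\cap Y|,\,|R_B^-\cap Y|\}\ge 2$.
   Context: **Problem.** Let $n\ge 3$, $V=[n]=\{1,\dots,n\}$, $A=\{(i,j): i,j\in V,\ i\ne j\}$. An input is a matrix $C=(c_{ij})$ with $c_{ij}\in\mathbb Z$ for $i\neq j$ and $c_{ii}=\infty$. For $H\subseteq A$ let $\mathrm{len}(H)=\sum_{(i,j)\in H}c_{ij}$. The task is to find a Hamiltonian circuit (directed Hamiltonian cycle) $H\subseteq A$ of minimum length. $X$ is the set of 0/1 characteristic vectors $\bm x=(x_{ij})$ of Hamiltonian circuits of $(V,A)$ and $\langle \bm x,C\rangle=\sum_{i\ne j}x_{ij}c_{ij}$. A solution $\bm x\in X$ is optimal for $C$ if $\langle \bm x,C\rangle\le\langle \bm y,C\rangle$ for all $\bm y\in X$. Distinct $\bm x,\bm y\in X$ are adjacent if there is an input $C$ for which $\bm x$ and $\bm y$, and no other elements of $X$, are optimal. $Y\subseteq X$ is a clique if its elements are pairwise adjacent. **Algorithm.** $I(M)$, $J(M)$ denote the sets of row and column indices of a matrix $M$; $M(S,T)$ is the submatrix with rows $S$ and columns $T$. Loops run over indices in increasing order. Conventions: $\infty\pm b=\infty$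 for integers $b$, $\infty+\infty=\infty-\infty=\infty$, $\infty>b$ for integers $b$, and $\infty>\infty$ is false. Global variables: $H_{opt}$ and $l_{opt}$, initially $l_{opt}=\infty$. The algorithm calls BranchBound$(C,\emptyset,0)$ and outputs the final $H_{opt}$ (as its characteristic vector). BranchBound$(M,Arcs,sum)$ (arguments passed by value): 1. Perform Reduction$(M,sum)$ (which modifies $M$ and $sum$). 2. If $sum\ge l_{opt}$, return. 3. $(i,j):=$ ChooseArc$(M)$. 4. If $|I(M)|=3$: let $H$ be the unique Hamiltonian circuit containing $Arcs\cup\{(i,j)\}$; if $\mathrm{len}(H)<l_{opt}$, set $H_{opt}:=H$, $l_{opt}:=\mathrm{len}(H)$. Otherwise: $M':=M(I(M)\setminus\{i\},J(M)\setminus\{j\})$; let $l$ and $k$ be the end and the beginning, respectively, of the inclusion-maximal path in $Arcs\cup\{(i,j)\}$ containing $(i,j)$; set $M'[l,k]:=\infty$; call BranchBound$(M',Arcs\cup\{(i,j)\},sum)$. 5. Set $M[i,j]:=\infty$ and call BranchBound$(M,Arcs,sum)$. Reduction$(M,sum)$: for each $i\in I(M)$: $m:=\infty$; for each $j\in J(M)$, if $m>M[i,j]$ then $m:=M[i,j]$; then $sum:=sum+m$ and $M[i,j]:=M[i,j]-m$ for all $j\in J(M)$. Then for each $j\in J(M)$: $m:=\infty$; for each $i\in I(M)$, if $m>M[i,j]$ then $m:=M[i,j]$; then $sum:=sum+m$ and $M[i,j]:=M[i,j]-m$ for all $i\in I(M)$. ChooseArc$(M)$: $w:=-1$. For each $i\in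 I(M)$, for each $j\in J(M)$: if $M[i,j]=0$, then: $m:=\infty$; for each $t\in J(M)\setminus\{j\}$, if $m>M[i,t]$ then $m:=M[i,t]$; $k:=\infty$; for each $t\in I(M)\setminus\{i\}$, if $k>M[t,j]$ then $k:=M[t,j]$; if $m+k>w$ then $w:=m+k$, $(i^*,j^* ):=(i,j)$. Return $(i^*,j^* )$. **The tree $\mathcal T_n$.** Every finite value handled by the algorithm (except the initial $w=-1$) is, for a given history of test outcomes, an integer linear form in the off-diagonal entries of $C$. Each test thus compares a linear form $\langle B,C\rangle$ with $0$: its outcome is $\langle B,C\rangle>0$ or $\langle B,C\rangle\le 0$ (for strict comparisons), or $\langle B,C\rangle\ge0$ or $\langle B,C\rangle<0$ (for non-strict ones). The test $M[i,j]=0$ is applied only to nonnegative entries and is regarded as the test $M[i,j]>0$. Tests involving $\infty$, the initial value $w=-1$, or two formally identical linear forms carry no information and are not counted. The internal nodes of $\mathcal T_n$ are the counted tests performed by the algorithm, two runs (on two inputs) being at the same node if and only if all their preceding counted tests had the same outcomes; only nodes reached by at least one input $C$ are considered. From each node leave a "positive" edge (sign $+1$, the outcome $\langle B,C\rangle>0$ or $\ge 0$) and a "negative" edge (sign $-1$, the opposite outcome). Leaves correspond to terminated runs and are labelled by the output $\bm x\in X$. For an internal node $B$, $X_B^+$ (resp. $X_B^-$) is the set of labels of leaves reached through the positive (resp. negative) edge out of $B$, i.e. the set of outputs over all inputs $C$ whose run passes through $B$ and leaves it along that edge. Put $R_B^-=X_B^+\setminus X_B^-$ and $R_B^+=X_B^-\setminus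 X_B^+$. **Direct type.** The tree is of direct type if for every internal node $B$ and every clique $Y\subseteq X$ one has $\min\{|R_B^+\cap Y|,|R_B^-\cap Y|\}\le 1$. The algorithm is a direct-type algorithm if $\mathcal T_n$ is of direct type for every $n\ge3$. *)

theory Defs
  imports
    Main
    "HOL-Library.Function_Algebras"
    "HOL-Library.Indicator_Function"
    "HOL-Library.Sublist"
begin

section \<open>The traveling salesman problem\<close>

type_synonym arc = "nat \<times> nat"

definition arcs :: "nat \<Rightarrow> arc set" where
  "arcs n = {(i, j). i \<in> {1..n} \<and> j \<in> {1..n} \<and> i \<noteq> j}"

text \<open>
  Inputs, linear forms in the entries of an input, and characteristic vectors all have the
  type \<open>arc \<Rightarrow> int\<close>.  Only the values on \<^term>\<open>arcs n\<close> of an input matter: the diagonal of the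
  matrix is \<open>\<infinity>\<close> by construction (see \<open>input_matrix\<close> below).
\<close>

definition inner :: "nat \<Rightarrow> (arc \<Rightarrow> int) \<Rightarrow> (arc \<Rightarrow> int) \<Rightarrow> int" where
  "inner n x C = (\<Sum>a\<in>arcs n. x a * C a)"

definition hamiltonian_circuit :: "nat \<Rightarrow> arc set \<Rightarrow> bool" where
  "hamiltonian_circuit n H \<longleftrightarrow>
     (\<exists>vs. distinct vs \<and> set vs = {1..n} \<and> H = set (zip vs (rotate1 vs)))"

definition solutions :: "nat \<Rightarrow> (arc \<Rightarrow> int) set" where
  "solutions n = {indicator H | H. hamiltonian_circuit n H}"

definition optimal :: "nat \<Rightarrow> (arc \<Rightarrow> int) \<Rightarrow> (arc \<Rightarrow> int) \<Rightarrow> bool" where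
  "optimal n C x \<longleftrightarrow> x \<in> solutions n \<and> (\<forall>y\<in>solutions n. inner n x C \<le> inner n y C)"

definition adjacent :: "nat \<Rightarrow> (arc \<Rightarrow> int) \<Rightarrow> (arc \<Rightarrow> int) \<Rightarrow> bool" where
  "adjacent n x y \<longleftrightarrow>
     x \<in> solutions n \<and> y \<in> solutions n \<and> x \<noteq> y \<and> (\<exists>C. {z. optimal n C z} = {x, y})"

definition clique :: "nat \<Rightarrow> (arc \<Rightarrow> int) set \<Rightarrow> bool" where
  "clique n Y \<longleftrightarrow> Y \<subseteq> solutions n \<and> (\<forall>x\<in>Y. \<forall>y\<in>Y. x \<noteq> y \<longrightarrow> adjacent n x y)"


section \<open>Symbolic values and tests\<close>

text \<open>
  The algorithm handles formal linear forms in the entries of the input (or \<open>\<infinity>\<close>), so that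
  formally identical forms can be recognised; the input \<open>C\<close> itself is only consulted in the tests.
\<close>

datatype val = Inf | Lin "arc \<Rightarrow> int"

fun vadd :: "val \<Rightarrow> val \<Rightarrow> val" where
  "vadd (Lin f) (Lin g) = Lin (f + g)"
| "vadd _ _ = Inf"

fun vsub :: "val \<Rightarrow> val \<Rightarrow> val" where
  "vsub (Lin f) (Lin g) = Lin (f - g)"
| "vsub _ _ = Inf"

text \<open>
  The record of the outcomes of the counted tests performed so far, in chronological order;
  \<^const>\<open>True\<close> is the sign \<open>+1\<close>.  All procedures take the current record and return the extended
  one.  Tests that involve \<open>\<infinity>\<close> or two identical forms leave the record unchanged.
\<close>

type_synonym history = "bool list"

text \<open>The tests \<open>u > v\<close> and \<open>u \<ge> v\<close>; the linear form compared with \<open>0\<close> is \<open>u - v\<close>.\<close>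

fun test_gt :: "nat \<Rightarrow> (arc \<Rightarrow> int) \<Rightarrow> val \<Rightarrow> val \<Rightarrow> history \<Rightarrow> bool \<times> history" where
  "test_gt n C (Lin f) (Lin g) h =
     (if f = g then (False, h) else (let p = inner n (f - g) C > 0 in (p, h @ [p])))"
| "test_gt n C Inf (Lin g) h = (True, h)"
| "test_gt n C u Inf h = (False, h)"

fun test_ge :: "nat \<Rightarrow> (arc \<Rightarrow> int) \<Rightarrow> val \<Rightarrow> val \<Rightarrow> history \<Rightarrow> bool \<times> history" where
  "test_ge n C (Lin f) (Lin g) h =
     (if f = g then (True, h) else (let p = inner n (f - g) C \<ge> 0 in (p, h @ [p])))"
| "test_ge n C Inf v h = (True, h)"
| "test_ge n C (Lin f) Inf h = (False, h)"

text \<open>The test \<open>v = 0\<close>, performed as the negation of \<open>v > 0\<close>.\<close>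

definition test_zero :: "nat \<Rightarrow> (arc \<Rightarrow> int) \<Rightarrow> val \<Rightarrow> history \<Rightarrow> bool \<times> history" where
  "test_zero n C v h = (let (p, h) = test_gt n C v (Lin 0) h in (\<not> p, h))"

text \<open>
  The test \<open>v > w\<close> in the choice of an arc; \<^const>\<open>None\<close> stands for the initial value \<open>w = -1\<close>,
  comparison with which is not recorded.
\<close>

fun test_weight :: "nat \<Rightarrow> (arc \<Rightarrow> int) \<Rightarrow> val \<Rightarrow> val option \<Rightarrow> history \<Rightarrow> bool \<times> history" where
  "test_weight n C Inf None h = (True, h)"
| "test_weight n C (Lin f) None h = (inner n f C > -1, h)"
| "test_weight n C v (Some w) h = test_gt n C v w h"

definition find_min :: "nat \<Rightarrow> (arc \<Rightarrow> int) \<Rightarrow> val list \<Rightarrow> history \<Rightarrow> val \<times> history" where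
  "find_min n C vs h =
     fold (\<lambda>v (m, h). let (p, h) = test_gt n C m v h in (if p then v else m, h)) vs (Inf, h)"


section \<open>The branch and bound algorithm\<close>

text \<open>
  A matrix is given by its increasing lists \<open>I\<close>, \<open>J\<close> of row and column indices and a function
  \<open>M\<close>, whose values outside \<open>set I \<times> set J\<close> are irrelevant.
\<close>

type_synonym matrix = "nat \<Rightarrow> nat \<Rightarrow> val"

definition set_entry :: "matrix \<Rightarrow> nat \<Rightarrow> nat \<Rightarrow> val \<Rightarrow> matrix" where
  "set_entry M i j v = M(i := (M i)(j := v))"

definition reduce_row ::
  "nat \<Rightarrow> (arc \<Rightarrow> int) \<Rightarrow> nat list \<Rightarrow> nat \<Rightarrow> matrix \<times> val \<times> history \<Rightarrow> matrix \<times> val \<times> history" where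
  "reduce_row n C J i = (\<lambda>(M, s, h).
     let (m, h) = find_min n C (map (\<lambda>j. M i j) J) h
     in (\<lambda>r c. if r = i \<and> c \<in> set J then vsub (M r c) m else M r c, vadd s m, h))"

definition reduce_col ::
  "nat \<Rightarrow> (arc \<Rightarrow> int) \<Rightarrow> nat list \<Rightarrow> nat \<Rightarrow> matrix \<times> val \<times> history \<Rightarrow> matrix \<times> val \<times> history" where
  "reduce_col n C I j = (\<lambda>(M, s, h).
     let (m, h) = find_min n C (map (\<lambda>i. M i j) I) h
     in (\<lambda>r c. if c = j \<and> r \<in> set I then vsub (M r c) m else M r c, vadd s m, h))"

definition reduction ::
  "nat \<Rightarrow> (arc \<Rightarrow> int) \<Rightarrow> nat list \<Rightarrow> nat list \<Rightarrow> matrix \<Rightarrow> val \<Rightarrow> history \<Rightarrow> matrix \<times> val \<times> history" where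
  "reduction n C I J M s h = fold (reduce_col n C I) J (fold (reduce_row n C J) I (M, s, h))"

text \<open>
  The state is the current \<open>(w, (i\<^sup>*, j\<^sup>*))\<close>, with \<^const>\<open>None\<close> as long as \<open>w = -1\<close>.
  \<^const>\<open>List.product\<close> enumerates the entries row by row.
\<close>

definition choose_step ::
  "nat \<Rightarrow> (arc \<Rightarrow> int) \<Rightarrow> nat list \<Rightarrow> nat list \<Rightarrow> matrix \<Rightarrow> arc
     \<Rightarrow> (val \<times> arc) option \<times> history \<Rightarrow> (val \<times> arc) option \<times> history" where
  "choose_step n C I J M = (\<lambda>(i, j) (best, h).
     let (z, h) = test_zero n C (M i j) h
     in if z then
          let (m, h) = find_min n C (map (\<lambda>t. M i t) (removeAll j J)) h;
              (k, h) = find_min n C (map (\<lambda>t. M t j) (removeAll i I)) h;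
              (p, h) = test_weight n C (vadd m k) (map_option fst best) h
          in (if p then Some (vadd m k, (i, j)) else best, h)
        else (best, h))"

definition choose_arc ::
  "nat \<Rightarrow> (arc \<Rightarrow> int) \<Rightarrow> nat list \<Rightarrow> nat list \<Rightarrow> matrix \<Rightarrow> history \<Rightarrow> arc option \<times> history" where
  "choose_arc n C I J M h =
     (let (best, h) = fold (choose_step n C I J M) (List.product I J) (None, h)
      in (map_option snd best, h))"

definition path_arcs :: "nat list \<Rightarrow> arc set" where
  "path_arcs vs = set (zip vs (tl vs))"

definition path_in :: "arc set \<Rightarrow> nat list \<Rightarrow> bool" where
  "path_in P vs \<longleftrightarrow> vs \<noteq> [] \<and> distinct vs \<and> path_arcs vs \<subseteq> P"

definition maximal_path :: "arc set \<Rightarrow> arc \<Rightarrow> nat list" where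
  "maximal_path P a =
     (THE vs. path_in P vs \<and> a \<in> path_arcs vs \<and>
        (\<forall>ws. path_in P ws \<and> path_arcs vs \<subseteq> path_arcs ws \<longrightarrow> ws = vs))"

definition completion :: "nat \<Rightarrow> arc set \<Rightarrow> arc set" where
  "completion n P = (THE H. hamiltonian_circuit n H \<and> P \<subseteq> H)"

text \<open>Termination of the algorithm: the pair (number of rows, number of finite entries) decreases.\<close>

definition finite_entries :: "nat list \<Rightarrow> nat list \<Rightarrow> matrix \<Rightarrow> arc set" where
  "finite_entries I J M = {(i, j). i \<in> set I \<and> j \<in> set J \<and> M i j \<noteq> Inf}"

lemma vsub_not_Inf: "vsub u v \<noteq> Inf \<Longrightarrow> u \<noteq> Inf"
  by (cases u) auto

lemma finite_entries_reduce_row: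
  "finite_entries I J (fst (reduce_row n C K i st)) \<subseteq> finite_entries I J (fst st)"
  by (auto simp: finite_entries_def reduce_row_def split: prod.splits if_splits
      dest: vsub_not_Inf)

lemma finite_entries_reduce_col:
  "finite_entries I J (fst (reduce_col n C K j st)) \<subseteq> finite_entries I J (fst st)"
  by (auto simp: finite_entries_def reduce_col_def split: prod.splits if_splits
      dest: vsub_not_Inf)

lemma finite_entries_reduction:
  "finite_entries I J (fst (reduction n C I J M s h)) \<subseteq> finite_entries I J M"
proof -
  have rows: "finite_entries I J (fst (fold (reduce_row n C K) xs st)) \<subseteq> finite_entries I J (fst st)"
    for K xs st
    proof (induction xs arbitrary: st)
    case (Cons x xs)
    then show ?case
      using finite_entries_reduce_row[of I J n C K x st] by (simp only: fold_simps) (rule subset_trans)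
  qed simp
  have cols: "finite_entries I J (fst (fold (reduce_col n C K) xs st)) \<subseteq> finite_entries I J (fst st)"
    for K xs st
    proof (induction xs arbitrary: st)
    case (Cons x xs)
    then show ?case
      using finite_entries_reduce_col[of I J n C K x st] by (simp only: fold_simps) (rule subset_trans)
  qed simp
  show ?thesis
    using cols[of I J "fold (reduce_row n C J) I (M, s, h)"] rows[of J I "(M, s, h)"]
    by (simp add: reduction_def)
qed

lemma choose_arc_finite_entry:
  assumes "choose_arc n C I J M h = (Some a, h')"
  shows "a \<in> finite_entries I J M"
proof -
  define ok where "ok = (\<lambda>b :: (val \<times> arc) option. \<forall>w a. b = Some (w, a) \<longrightarrow> a \<in> finite_entries I J M)"
  have step: "ok (fst (choose_step n C I J M e st))"
    if "e \<in> set (List.product I J)" "ok (fst st)" for e st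
    using that
    by (cases "M (fst e) (snd e)")
      (auto simp: ok_def choose_step_def finite_entries_def test_zero_def split: prod.splits if_splits)
  have "ok (fst (fold (choose_step n C I J M) es st))"
    if "set es \<subseteq> set (List.product I J)" "ok (fst st)" for es st
    using that
  proof (induction es arbitrary: st)
    case (Cons e es)
    then have "ok (fst (choose_step n C I J M e st))"
      by (intro step) simp_all
    with Cons show ?case
      by (simp del: set_product)
  qed simp
  from this[of "List.product I J" "(None, h)"] show ?thesis
    using assms by (auto simp: ok_def choose_arc_def split: prod.splits)
qed

lemma length_rows_less:
  assumes "(Some (i, j), h') = choose_arc n C I J M h"
  shows "length (removeAll i I) < length I"
  using choose_arc_finite_entry[OF assms[symmetric]]
  by (auto simp: finite_entries_def length_removeAll_less)

lemma finite_entries_less: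
  assumes "(M, s, h1) = reduction n C I J M0 s0 h0" and "(Some (i, j), h3) = choose_arc n C I J M h2"
  shows "card (finite_entries I J (set_entry M i j Inf)) < card (finite_entries I J M0)"
proof (rule psubset_card_mono)
  show "finite (finite_entries I J M0)"
    by (rule finite_subset[of _ "set I \<times> set J"]) (auto simp: finite_entries_def)
  have "finite_entries I J M \<subseteq> finite_entries I J M0"
    using finite_entries_reduction[of I J n C M0 s0 h0] unfolding assms(1)[symmetric] by simp
  moreover have "(i, j) \<in> finite_entries I J M"
    using choose_arc_finite_entry[OF assms(2)[symmetric]] .
  moreover have "finite_entries I J (set_entry M i j Inf) \<subseteq> finite_entries I J M - {(i, j)}"
    by (auto simp: finite_entries_def set_entry_def split: if_splits)
  ultimately show "finite_entries I J (set_entry M i j Inf) \<subset> finite_entries I J M0"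
    by blast
qed

text \<open>
  \<open>branch_bound n C I J M P s (H, l, h)\<close>: here \<open>P\<close> is \<open>Arcs\<close>, \<open>s\<close> is \<open>sum\<close>, and the last
  argument and the result consist of the global variables \<open>H\<^sub>o\<^sub>p\<^sub>t\<close>, \<open>l\<^sub>o\<^sub>p\<^sub>t\<close> and the record of
  tests.  A reduced matrix with a finite \<open>s\<close> has a zero in every row, so the case \<^const>\<open>None\<close>
  does not occur in a run.
\<close>

function branch_bound ::
  "nat \<Rightarrow> (arc \<Rightarrow> int) \<Rightarrow> nat list \<Rightarrow> nat list \<Rightarrow> matrix \<Rightarrow> arc set \<Rightarrow> val
     \<Rightarrow> arc set \<times> val \<times> history \<Rightarrow> arc set \<times> val \<times> history" where
  "branch_bound n C I J M0 P s0 (H, l, h0) =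
     (let (M, s, h1) = reduction n C I J M0 s0 h0;
          (stop, h2) = test_ge n C s l h1
      in if stop then (H, l, h2)
         else
           (case choose_arc n C I J M h2 of
              (None, h3) \<Rightarrow> (H, l, h3)
            | (Some (i, j), h3) \<Rightarrow>
                branch_bound n C I J (set_entry M i j Inf) P s
                  (if length I = 3 then
                     (let H' = completion n (insert (i, j) P);
                          (p, h4) = test_gt n C l (Lin (indicator H')) h3
                      in if p then (H', Lin (indicator H'), h4) else (H, l, h4))
                   else
                     (let vs = maximal_path (insert (i, j) P) (i, j)
                      in branch_bound n C (removeAll i I) (removeAll j J)
                           (set_entry M (last vs) (hd vs) Inf) (insert (i, j) P) s (H, l, h3)))))"
  by pat_completeness auto

termination
  by (relation "measures [\<lambda>(n, C, I, J, M, P, s, st). length I,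
                          \<lambda>(n, C, I, J, M, P, s, st). card (finite_entries I J M)]")
    (auto dest: length_rows_less finite_entries_less)

definition input_matrix :: matrix where
  "input_matrix i j = (if i = j then Inf else Lin (indicator {(i, j)}))"

definition run :: "nat \<Rightarrow> (arc \<Rightarrow> int) \<Rightarrow> arc set \<times> val \<times> history" where
  "run n C = branch_bound n C [1..<Suc n] [1..<Suc n] input_matrix {} (Lin 0) ({}, Inf, [])"

definition algorithm_output :: "nat \<Rightarrow> (arc \<Rightarrow> int) \<Rightarrow> (arc \<Rightarrow> int)" where
  "algorithm_output n C = indicator (fst (run n C))"

definition history_of :: "nat \<Rightarrow> (arc \<Rightarrow> int) \<Rightarrow> history" where
  "history_of n C = snd (snd (run n C))"


section \<open>The linear separating tree\<close>

text \<open>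
  A node is identified with the outcomes of the tests that precede it.  It is an internal node if
  some input performs at least one further counted test there.
\<close>

definition internal_nodes :: "nat \<Rightarrow> history set" where
  "internal_nodes n = {B. \<exists>C. strict_prefix B (history_of n C)}"

definition X_plus :: "nat \<Rightarrow> history \<Rightarrow> (arc \<Rightarrow> int) set" where
  "X_plus n B = {algorithm_output n C | C. prefix (B @ [True]) (history_of n C)}"

definition X_minus :: "nat \<Rightarrow> history \<Rightarrow> (arc \<Rightarrow> int) set" where
  "X_minus n B = {algorithm_output n C | C. prefix (B @ [False]) (history_of n C)}"

text \<open>The signs are crossed on purpose: \<open>R\<close> with sign \<open>-\<close> consists of the labels that are lost
  when the run leaves \<open>B\<close> along the negative edge.\<close>

definition R_minus :: "nat \<Rightarrow> history \<Rightarrow> (arc \<Rightarrow> int) set" where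
  "R_minus n B = X_plus n B - X_minus n B"

definition R_plus :: "nat \<Rightarrow> history \<Rightarrow> (arc \<Rightarrow> int) set" where
  "R_plus n B = X_minus n B - X_plus n B"

definition direct_type_tree :: "nat \<Rightarrow> bool" where
  "direct_type_tree n \<longleftrightarrow>
     (\<forall>B\<in>internal_nodes n. \<forall>Y. clique n Y \<longrightarrow>
        min (card (R_plus n B \<inter> Y)) (card (R_minus n B \<inter> Y)) \<le> 1)"

definition direct_type_algorithm :: bool where
  "direct_type_algorithm \<longleftrightarrow> (\<forall>n\<ge>3. direct_type_tree n)"

end

theory Submission
  imports Defs
begin

text \<open>
  Take \<open>n = 5\<close>.  The algorithm returns an optimal circuit, because at every subproblem the length of
  each remaining circuit is \<open>sum\<close> plus the reduced entries on its undecided arcs.  Hence a circuit is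
  excluded from the outputs behind an edge as soon as the recorded outcomes force another circuit to
  be strictly shorter.  The node is reached during the very first row reductions, where all tests compare
  two entries of the same row.  It is entered when \<open>c\<^sub>1\<^sub>5 < c\<^sub>1\<^sub>4 < c\<^sub>1\<^sub>3 < c\<^sub>1\<^sub>2\<close>,
  \<open>c\<^sub>2\<^sub>3\<close> and \<open>c\<^sub>3\<^sub>2\<close> are minimal in their rows and \<open>c\<^sub>4\<^sub>2 < c\<^sub>4\<^sub>1\<close>; its test is
  \<open>c\<^sub>4\<^sub>2 > c\<^sub>4\<^sub>3\<close>.  If \<open>c\<^sub>4\<^sub>2 \<le> c\<^sub>4\<^sub>3\<close>, then 12435 loses to 14235 and 12543 to 15423;
  if \<open>c\<^sub>4\<^sub>2 > c\<^sub>4\<^sub>3\<close>, then 13425 loses to 14325 and 13542 to 15432, arc by arc.  Each of the four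
  losing circuits is the unique optimum of some input on the other side of the test, and the union of
  any two of them contains no third circuit, so they form a clique.
\<close>

section \<open>Degrees, connectedness and length of a tour\<close>

section \<open>Hamiltonian circuits\<close>

definition circuit :: "nat list \<Rightarrow> arc set" where
  "circuit vs = set (zip vs (rotate1 vs))"

lemma hamiltonian_circuit_iff:
  "hamiltonian_circuit n H \<longleftrightarrow> (\<exists>vs. distinct vs \<and> set vs = {1..n} \<and> H = circuit vs)"
  by (simp add: hamiltonian_circuit_def circuit_def)

lemma finite_arcs: "finite (arcs n)"
  by (rule finite_subset[of _ "{1..n} \<times> {1..n}"]) (auto simp: arcs_def)

lemma circuit_eq_nth: "circuit vs = {(vs ! k, vs ! (Suc k mod length vs)) | k. k < length vs}"
  by (auto simp: circuit_def set_zip nth_rotate1)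

text \<open>Opens the cycle at its closing arc, so that facts about \<open>path_arcs\<close>
  transfer to circuits.\<close>

lemma circuit_eq_path:
  assumes "vs \<noteq> []"
  shows "circuit vs = insert (last vs, hd vs) (path_arcs vs)"
proof -
  obtain xs x where vs: "vs = xs @ [x]"
    using assms rev_exhaust by blast
  show ?thesis
  proof (cases xs)
    case Nil
    then show ?thesis by (simp add: vs circuit_def path_arcs_def)
  next
    case (Cons y ys)
    have "zip (xs @ [x]) ((ys @ [x]) @ [y]) = zip xs (ys @ [x]) @ [(x, y)]"
      by (subst zip_append) (simp_all add: Cons)
    moreover have "zip (xs @ [x]) (ys @ [x]) = zip xs (ys @ [x])"
      using zip_append1[of xs "[x]" "ys @ [x]"] by (simp add: Cons)
    ultimately show ?thesis
      by (simp add: vs Cons circuit_def path_arcs_def)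
  qed
qed

text \<open>A tour is connected: following successors from one position of the defining list visits
  all positions cyclically.\<close>

lemma tour_closed_set:
  assumes "hamiltonian_circuit n H" and "S \<subseteq> {1..n}" and "S \<noteq> {}"
    and closed: "\<And>i j. (i, j) \<in> H \<Longrightarrow> i \<in> S \<Longrightarrow> j \<in> S"
  shows "S = {1..n}"
proof -
  obtain vs where vs: "distinct vs" "set vs = {1..n}" "H = circuit vs"
    using assms(1) by (auto simp: hamiltonian_circuit_iff)
  obtain k where k: "k < length vs" "vs ! k \<in> S"
    using assms(2,3) vs(2) by (metis ex_in_conv in_set_conv_nth subsetD)
  have reach: "vs ! ((k + m) mod length vs) \<in> S" for m
  proof (induction m)
    case (Suc m)
    have "(k + m) mod length vs < length vs"
      using k by (intro mod_less_divisor) linarith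
    then have "(vs ! ((k + m) mod length vs), vs ! (Suc ((k + m) mod length vs) mod length vs)) \<in> H"
      unfolding vs(3) circuit_eq_nth by blast
    then show ?case
      using closed[OF _ Suc] by (simp add: mod_Suc_eq)
  qed (use k in simp)
  \<comment> \<open>Position \<open>q\<close> is reached from \<open>k\<close> after
    \<open>q + length vs - k\<close> steps; adding the length keeps the natural subtraction from
    truncating and vanishes modulo \<open>length vs\<close>.\<close>
  have "vs ! q \<in> S" if "q < length vs" for q
    using reach[of "q + length vs - k"] that k by simp
  then show ?thesis
    using assms(2) vs(2) by (metis in_set_conv_nth subsetI subset_antisym)
qed

lemma tour_succ_ex:
  assumes "hamiltonian_circuit n H" and "i \<in> {1..n}"
  shows "\<exists>j. (i, j) \<in> H"
proof -
  obtain vs where vs: "set vs = {1..n}" "H = circuit vs"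
    using assms(1) by (auto simp: hamiltonian_circuit_iff)
  then obtain k where "k < length vs" "i = vs ! k"
    using assms(2) by (metis in_set_conv_nth)
  then show ?thesis
    unfolding vs(2) circuit_eq_nth by blast
qed

lemma tour_succ_unique:
  assumes "hamiltonian_circuit n H" and "(i, j) \<in> H" and "(i, j') \<in> H"
  shows "j = j'"
  using assms by (auto simp: hamiltonian_circuit_iff circuit_eq_nth nth_eq_iff_index_eq)

lemma Suc_mod_inj:
  assumes "Suc k mod m = Suc k' mod m" and "k < m" and "k' < m"
  shows "k = k'"
  using assms by (auto simp: mod_Suc split: if_splits)

lemma tour_pred_unique:
  assumes "hamiltonian_circuit n H" and "(i, j) \<in> H" and "(i', j) \<in> H"
  shows "i = i'"
proof -
  obtain vs where vs: "distinct vs" "H = circuit vs"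
    using assms(1) by (auto simp: hamiltonian_circuit_iff)
  obtain k k' where k: "k < length vs" "k' < length vs" "i = vs ! k" "i' = vs ! k'"
      "vs ! (Suc k mod length vs) = vs ! (Suc k' mod length vs)"
    using assms(2,3) unfolding vs(2) circuit_eq_nth by auto
  have "Suc k mod length vs < length vs" "Suc k' mod length vs < length vs"
    using k(1) by (intro mod_less_divisor; linarith)+
  then have "Suc k mod length vs = Suc k' mod length vs"
    using k(5) vs(1) nth_eq_iff_index_eq by blast
  then show ?thesis
    using Suc_mod_inj k by blast
qed

text \<open>With a single vertex the circuit would be the loop (1,1), which \<open>arcs\<close>
  excludes; from two vertices on, cyclically consecutive positions differ.\<close>

lemma tour_subset_arcs:
  assumes "hamiltonian_circuit n H" and "2 \<le> n"
  shows "H \<subseteq> arcs n"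
proof -
  obtain vs where vs: "distinct vs" "set vs = {1..n}" "H = circuit vs"
    using assms(1) by (auto simp: hamiltonian_circuit_iff)
  have len: "length vs = n"
    using vs distinct_card by fastforce
  have "vs ! k \<in> {1..n}" "vs ! (Suc k mod n) \<in> {1..n}" "vs ! k \<noteq> vs ! (Suc k mod n)"
    if "k < n" for k
  proof -
    have m: "Suc k mod n < n" "Suc k mod n \<noteq> k"
      using that assms(2) by (auto simp: mod_Suc)
    then show "vs ! k \<noteq> vs ! (Suc k mod n)"
      using that vs(1) len by (simp add: nth_eq_iff_index_eq)
    show "vs ! k \<in> {1..n}" "vs ! (Suc k mod n) \<in> {1..n}"
      using that m len vs(2) nth_mem by blast+
  qed
  then show ?thesis
    unfolding vs(3) circuit_eq_nth len arcs_def by blast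
qed

lemma inner_tour:
  assumes "hamiltonian_circuit n H" and "2 \<le> n"
  shows "inner n (indicator H) C = sum C H"
proof -
  have "inner n (indicator H) C = (\<Sum>a\<in>arcs n. if a \<in> H then C a else 0)"
    unfolding inner_def by (intro sum.cong) (simp_all add: indicator_def)
  also have "\<dots> = sum C H"
    using tour_subset_arcs[OF assms] by (simp add: sum.If_cases finite_arcs Int_absorb1)
  finally show ?thesis .
qed


section \<open>Partial tours as families of disjoint paths, and the tours extending them\<close>

section \<open>Path covers\<close>

lemma path_arcs_simps [simp]:
  "path_arcs [] = {}" "path_arcs [x] = {}"
  "path_arcs (x # y # zs) = insert (x, y) (path_arcs (y # zs))"
  by (simp_all add: path_arcs_def)

lemma path_arcs_append:
  assumes "p \<noteq> []" and "q \<noteq> []"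
  shows "path_arcs (p @ q) = insert (last p, hd q) (path_arcs p \<union> path_arcs q)"
  using assms(1)
proof (induction p rule: induct_list012)
  case (2 x)
  then show ?case using assms(2) by (cases q) auto
qed auto

lemma path_arcs_decomp:
  assumes "(i, j) \<in> path_arcs p"
  obtains a b where "p = a @ i # j # b"
  using assms
proof (induction p arbitrary: thesis rule: induct_list012)
  case (3 x y zs)
  show ?case
  proof (cases "(i, j) = (x, y)")
    case True
    then show ?thesis using 3(3)[of "[]" zs] by simp
  next
    case False
    then have "(i, j) \<in> path_arcs (y # zs)" using 3(4) by auto
    then obtain a b where "y # zs = a @ i # j # b" using 3(2) by blast
    then show ?thesis using 3(3)[of "x # a" b] by simp
  qed
qed auto

lemma path_arcs_iff: "(i, j) \<in> path_arcs p \<longleftrightarrow> (\<exists>a b. p = a @ i # j # b)"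
proof
  assume "\<exists>a b. p = a @ i # j # b"
  then obtain a b where "p = a @ i # j # b" by blast
  then show "(i, j) \<in> path_arcs p"
    by (cases "a = []") (simp_all add: path_arcs_append)
qed (blast elim: path_arcs_decomp)

lemma path_arcs_verts:
  assumes "(i, j) \<in> path_arcs p"
  shows "i \<in> set p" and "j \<in> set p"
  using assms by (auto simp: path_arcs_iff)

lemma path_arcs_ends:
  assumes "(i, j) \<in> path_arcs p" and "distinct p"
  shows "i \<noteq> last p" and "j \<noteq> hd p"
proof -
  obtain a b where p: "p = a @ i # j # b" using assms(1) by (rule path_arcs_decomp)
  have "last p \<in> set (j # b)" by (simp add: p)
  then show "i \<noteq> last p" using assms(2) by (auto simp: p)
  have "hd p \<in> set (a @ [i])" by (cases a) (simp_all add: p)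
  then show "j \<noteq> hd p" using assms(2) by (auto simp: p)
qed

lemma path_succ_ex:
  assumes "i \<in> set p" and "i \<noteq> last p"
  shows "\<exists>j. (i, j) \<in> path_arcs p"
proof -
  obtain a b where p: "p = a @ i # b" using assms(1) by (meson split_list)
  with assms(2) obtain c d where "b = c # d" by (cases b) auto
  then show ?thesis using p by (auto simp: path_arcs_iff)
qed

lemma path_pred_ex:
  assumes "j \<in> set p" and "j \<noteq> hd p"
  shows "\<exists>i. (i, j) \<in> path_arcs p"
proof -
  obtain a b where p: "p = a @ j # b" using assms(1) by (meson split_list)
  with assms(2) obtain c d where "a = c @ [d]" by (cases a rule: rev_cases) auto
  then have "p = c @ d # j # b" using p by simp
  then show ?thesis by (auto simp: path_arcs_iff)
qed

text \<open>The combinatorial state of a subproblem: \<open>P\<close> splits the vertices into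
  disjoint paths, isolated vertices being paths without arcs. The ends of the paths are the
  remaining rows, their beginnings the remaining columns.\<close>

definition path_cover :: "nat \<Rightarrow> nat list set \<Rightarrow> arc set \<Rightarrow> bool" where
  "path_cover n Q P \<longleftrightarrow> finite Q \<and> (\<forall>p\<in>Q. p \<noteq> [] \<and> distinct p) \<and>
     (\<forall>p\<in>Q. \<forall>q\<in>Q. p \<noteq> q \<longrightarrow> set p \<inter> set q = {}) \<and>
     (\<Union>p\<in>Q. set p) = {1..n} \<and> P = (\<Union>p\<in>Q. path_arcs p)"

lemma path_cover_same:
  assumes "path_cover n Q P" and "p \<in> Q" and "q \<in> Q" and "x \<in> set p" and "x \<in> set q"
  shows "p = q"
  using assms by (auto simp: path_cover_def)

lemma path_cover_singletons: "path_cover n ((\<lambda>i. [i]) ` {1..n}) {}"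
  by (auto simp: path_cover_def)

text \<open>Models the inclusion branch: the chosen arc concatenates two paths.\<close>

lemma path_cover_join:
  assumes pc: "path_cover n Q P" and pq: "p \<in> Q" "q \<in> Q" "p \<noteq> q"
  shows "path_cover n (insert (p @ q) (Q - {p, q})) (insert (last p, hd q) P)"
proof -
  have ne: "p \<noteq> []" "q \<noteq> []" and disj: "set p \<inter> set q = {}" and d: "distinct p" "distinct q"
    using assms by (auto simp: path_cover_def)
  have 1: "(\<Union>r\<in>insert (p @ q) (Q - {p, q}). set r) = (\<Union>r\<in>Q. set r)"
    using pq by auto
  have 2: "(\<Union>r\<in>insert (p @ q) (Q - {p, q}). path_arcs r) = insert (last p, hd q) (\<Union>r\<in>Q. path_arcs r)"
    using pq by (auto simp: path_arcs_append[OF ne])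
  have 3: "set r \<inter> set (p @ q) = {}" if "r \<in> Q - {p, q}" for r
    using path_cover_same[OF pc] pq that by auto
  have 4: "set r \<inter> set r' = {}" if "r \<in> Q - {p, q}" "r' \<in> Q - {p, q}" "r \<noteq> r'" for r r'
    using path_cover_same[OF pc] that by blast
  have 5: "\<forall>r\<in>insert (p @ q) (Q - {p, q}). \<forall>r'\<in>insert (p @ q) (Q - {p, q}).
      r \<noteq> r' \<longrightarrow> set r \<inter> set r' = {}"
    using 3 4 by (metis inf_commute insertE)
  have 6: "finite Q" "\<forall>r\<in>Q. r \<noteq> [] \<and> distinct r" "(\<Union>r\<in>Q. set r) = {1..n}"
      "P = (\<Union>r\<in>Q. path_arcs r)"
    using pc by (simp_all add: path_cover_def)
  have 7: "\<forall>r\<in>insert (p @ q) (Q - {p, q}). r \<noteq> [] \<and> distinct r"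
    using 6(2) ne d disj by simp
  show ?thesis
    unfolding path_cover_def 1 2 using 5 6 7 by blast
qed

text \<open>Makes the count exact: the concatenation is a new element of the family, so each
  inclusion lowers the number of paths by one.\<close>

lemma path_cover_join_notin:
  assumes "path_cover n Q P" and "p \<in> Q" "q \<in> Q" "p \<noteq> q"
  shows "p @ q \<notin> Q - {p, q}"
proof
  assume a: "p @ q \<in> Q - {p, q}"
  have "p \<noteq> []" using assms by (auto simp: path_cover_def)
  then have "hd p \<in> set p" "hd p \<in> set (p @ q)" by simp_all
  then show False using path_cover_same[OF assms(1,2)] a by blast
qed

text \<open>Each arc of \<open>P\<close> stays inside one path of the cover, so \<open>ws\<close>
  never leaves \<open>p\<close>; distinctness of the vertices then fixes its position there.\<close>

lemma path_cover_sublist: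
  assumes pc: "path_cover n Q P" and p: "p \<in> Q" and "path_in P ws" and "set ws \<inter> set p \<noteq> {}"
  shows "\<exists>a b. p = a @ ws @ b"
  using assms(3,4)
proof (induction ws rule: induct_list012)
  case (2 x)
  then show ?case by (auto dest: split_list)
next
  case (3 x y zs)
  have pi: "path_in P (y # zs)" using 3(3) by (auto simp: path_in_def)
  have "(x, y) \<in> P" using 3(3) by (auto simp: path_in_def)
  then obtain r where r: "r \<in> Q" "(x, y) \<in> path_arcs r"
    using pc by (auto simp: path_cover_def)
  have rp: "r = p"
  proof (cases "x \<in> set p")
    case True
    then show ?thesis using path_cover_same[OF pc r(1) p] path_arcs_verts[OF r(2)] by blast
  next
    case False
    then have "set (y # zs) \<inter> set p \<noteq> {}" using 3(4) by simp
    then obtain a b where "p = a @ (y # zs) @ b" using 3(2)[OF pi] by blast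
    then have "y \<in> set p" by simp
    then show ?thesis using path_cover_same[OF pc r(1) p] path_arcs_verts[OF r(2)] by blast
  qed
  then have xy: "(x, y) \<in> path_arcs p" using r by simp
  then have "set (y # zs) \<inter> set p \<noteq> {}" using path_arcs_verts(2) by fastforce
  then obtain a b where ab: "p = a @ (y # zs) @ b" using 3(2)[OF pi] by blast
  obtain c d where cd: "p = c @ x # y # d" using xy by (rule path_arcs_decomp)
  have dp: "distinct p" using pc p by (auto simp: path_cover_def)
  \<comment> \<open>Both decompositions of \<open>p\<close> cut at \<open>y\<close>, which occurs
    only once, so the parts before it agree.\<close>
  have "(c @ [x]) @ y # d = a @ y # (zs @ b)" using ab cd by simp
  moreover have "y \<notin> set (c @ [x])" using dp[unfolded cd] by auto
  moreover have "y \<notin> set d" using dp[unfolded cd] by auto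
  ultimately have "c @ [x] = a" using append_Cons_eq_iff by metis
  then have "p = c @ (x # y # zs) @ b" using ab by simp
  then show ?case by blast
qed (simp add: path_in_def)

text \<open>By \<open>path_cover_sublist\<close> every path in \<open>P\<close> through
  \<open>a\<close> is a segment of \<open>p\<close>, so \<open>p\<close> is the only maximal one and
  the definite description is resolved.\<close>

lemma maximal_path_eq:
  assumes pc: "path_cover n Q P" and p: "p \<in> Q" and a: "a \<in> path_arcs p"
  shows "maximal_path P a = p"
proof -
  obtain i j where ij: "a = (i, j)" by (cases a)
  have pin: "path_in P p" using pc p by (auto simp: path_in_def path_cover_def)
  have sub: "\<exists>c d. p = c @ ws @ d" if "path_in P ws" "a \<in> path_arcs ws" for ws
  proof -
    have "i \<in> set ws" "i \<in> set p" using path_arcs_verts that(2) a ij by auto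
    then show ?thesis using path_cover_sublist[OF pc p that(1)] by blast
  qed
  have arcs_mono: "path_arcs ws \<subseteq> path_arcs p" if "p = c @ ws @ d" for c ws d
    using that by (auto simp: path_arcs_iff) (metis append.assoc append_Cons)
  have max: "ws = p" if ws: "path_in P ws" "path_arcs p \<subseteq> path_arcs ws" for ws
  proof -
    have ws_a: "a \<in> path_arcs ws" using a ws(2) by blast
    then obtain c d where cd: "p = c @ ws @ d" using sub ws(1) by blast
    have dp: "distinct p" using pin by (simp add: path_in_def)
    have wsne: "ws \<noteq> []" using ws(1) by (simp add: path_in_def)
    have "c = []"
    proof (rule ccontr)
      assume c: "c \<noteq> []"
      then have "(last c, hd (ws @ d)) \<in> path_arcs p"
        using wsne by (simp add: cd path_arcs_append)
      then have "last c \<in> set ws" using ws(2) path_arcs_verts(1) by blast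
      then show False using dp last_in_set[OF c] by (auto simp: cd)
    qed
    moreover have "d = []"
    proof (rule ccontr)
      assume d: "d \<noteq> []"
      have "(last (c @ ws), hd d) \<in> path_arcs ((c @ ws) @ d)"
        using wsne d by (subst path_arcs_append) auto
      then have "hd d \<in> set ws" using ws(2) path_arcs_verts(2) cd by fastforce
      then show False using dp hd_in_set[OF d] by (auto simp: cd)
    qed
    ultimately show ?thesis using cd by simp
  qed
  show ?thesis
    unfolding maximal_path_def
  proof (rule the_equality)
    show "path_in P p \<and> a \<in> path_arcs p \<and>
        (\<forall>ws. path_in P ws \<and> path_arcs p \<subseteq> path_arcs ws \<longrightarrow> ws = p)"
      using pin a max by blast
    fix vs
    assume vs: "path_in P vs \<and> a \<in> path_arcs vs \<and>
        (\<forall>ws. path_in P ws \<and> path_arcs vs \<subseteq> path_arcs ws \<longrightarrow> ws = vs)"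
    then obtain c d where "p = c @ vs @ d" using sub by blast
    then have "path_arcs vs \<subseteq> path_arcs p" by (rule arcs_mono)
    then show "vs = p" using vs pin by blast
  qed
qed

text \<open>Closing \<open>p\<close> would make its vertex set closed under successors in
  \<open>H\<close>, hence the set of all vertices, although \<open>q\<close> has vertices elsewhere.
  This is why the algorithm may forbid the arc from the end to the beginning of the maximal
  path.\<close>

lemma tour_no_subtour:
  assumes H: "hamiltonian_circuit n H" and pc: "path_cover n Q P" and PH: "P \<subseteq> H"
    and p: "p \<in> Q" and q: "q \<in> Q" "q \<noteq> p"
  shows "(last p, hd p) \<notin> H"
proof
  assume l: "(last p, hd p) \<in> H"
  have ne: "p \<noteq> []" "q \<noteq> []" and sp: "set p \<subseteq> {1..n}" and disj: "set p \<inter> set q = {}" and sq: "set q \<subseteq> {1..n}"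
    using assms by (auto simp: path_cover_def)
  have "j \<in> set p" if ij: "(i, j) \<in> H" "i \<in> set p" for i j
  proof (cases "i = last p")
    case True
    then have "j = hd p" using tour_succ_unique[OF H] that(1) l by blast
    then show ?thesis using ne by simp
  next
    case False
    then obtain k where k: "(i, k) \<in> path_arcs p" using path_succ_ex ij(2) by blast
    then have "(i, k) \<in> H" using PH pc p by (auto simp: path_cover_def)
    then have "j = k" using tour_succ_unique[OF H] that(1) by blast
    then show ?thesis using path_arcs_verts[OF k] by simp
  qed
  then have "set p = {1..n}" using tour_closed_set[OF H sp] ne by blast
  then show False using disj sq ne by (metis Int_absorb1 set_empty2)
qed

lemma tour_pred_ex:
  assumes "hamiltonian_circuit n H" and "j \<in> {1..n}"
  shows "\<exists>i. (i, j) \<in> H"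
proof -
  obtain vs where vs: "distinct vs" "set vs = {1..n}" "H = circuit vs"
    using assms(1) by (auto simp: hamiltonian_circuit_iff)
  then have j: "j \<in> set vs" using assms(2) by blast
  then have ne: "vs \<noteq> []" by auto
  then show ?thesis
    using path_pred_ex[OF j] by (auto simp: vs(3) circuit_eq_path)
qed

text \<open>A vertex that is not the end of its path has its successor fixed by \<open>P\<close>,
  and one that is not the beginning its predecessor; the rest of the tour matches ends with
  beginnings.\<close>

lemma tour_diff_matching:
  assumes H: "hamiltonian_circuit n H" and pc: "path_cover n Q P" and PH: "P \<subseteq> H"
  shows "H - P \<subseteq> last ` Q \<times> hd ` Q"
    and "\<And>i. i \<in> last ` Q \<Longrightarrow> \<exists>j. (i, j) \<in> H - P"
    and "\<And>j. j \<in> hd ` Q \<Longrightarrow> \<exists>i. (i, j) \<in> H - P"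
proof -
  have Pp: "path_arcs p \<subseteq> P" if "p \<in> Q" for p using pc that by (auto simp: path_cover_def)
  have V: "(\<Union>p\<in>Q. set p) = {1..n}" using pc by (simp add: path_cover_def)
  have HV: "i \<in> {1..n} \<and> j \<in> {1..n}" if "(i, j) \<in> H" for i j
  proof -
    obtain vs where vs: "set vs = {1..n}" "H = circuit vs"
      using H by (auto simp: hamiltonian_circuit_iff)
    have "(i, j) \<in> set (zip vs (rotate1 vs))"
      using that by (simp add: vs circuit_def)
    then have "i \<in> set vs" "j \<in> set vs"
      by (auto dest: set_zip_leftD set_zip_rightD)
    then show ?thesis
      by (simp add: vs)
  qed
  show "H - P \<subseteq> last ` Q \<times> hd ` Q"
  proof
    fix a assume "a \<in> H - P"
    then obtain i j where ij: "a = (i, j)" "(i, j) \<in> H" "(i, j) \<notin> P" by (cases a) auto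
    obtain p where p: "p \<in> Q" "i \<in> set p" using V HV[OF ij(2)] by blast
    have "i = last p"
    proof (rule ccontr)
      assume "i \<noteq> last p"
      then obtain k where "(i, k) \<in> P" using path_succ_ex p Pp by blast
      then show False using tour_succ_unique[OF H ij(2)] PH ij(3) by blast
    qed
    moreover obtain q where q: "q \<in> Q" "j \<in> set q" using V HV[OF ij(2)] by blast
    moreover have "j = hd q"
    proof (rule ccontr)
      assume "j \<noteq> hd q"
      then obtain k where "(k, j) \<in> P" using path_pred_ex q Pp by blast
      then show False using tour_pred_unique[OF H ij(2)] PH ij(3) by blast
    qed
    ultimately show "a \<in> last ` Q \<times> hd ` Q" using p ij by blast
  qed
  show "\<exists>j. (i, j) \<in> H - P" if "i \<in> last ` Q" for i
  proof -
    obtain p where p: "p \<in> Q" "i = last p" "p \<noteq> []" using \<open>i \<in> last ` Q\<close> pc by (auto simp: path_cover_def)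
    then have ip: "i \<in> set p" by simp
    then obtain j where j: "(i, j) \<in> H" using tour_succ_ex[OF H] V p(1) by blast
    have "(i, j) \<notin> P"
    proof
      assume "(i, j) \<in> P"
      then obtain r where r: "r \<in> Q" "(i, j) \<in> path_arcs r" using pc by (auto simp: path_cover_def)
      then have "r = p" using path_cover_same[OF pc r(1) p(1)] path_arcs_verts ip by blast
      then show False using path_arcs_ends(1)[OF r(2)] p pc by (auto simp: path_cover_def)
    qed
    then show ?thesis using j by blast
  qed
  show "\<exists>i. (i, j) \<in> H - P" if "j \<in> hd ` Q" for j
  proof -
    obtain p where p: "p \<in> Q" "j = hd p" "p \<noteq> []" using \<open>j \<in> hd ` Q\<close> pc by (auto simp: path_cover_def)
    then have jp: "j \<in> set p" by simp
    then obtain i where i: "(i, j) \<in> H" using tour_pred_ex[OF H] V p(1) by blast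
    have "(i, j) \<notin> P"
    proof
      assume "(i, j) \<in> P"
      then obtain r where r: "r \<in> Q" "(i, j) \<in> path_arcs r" using pc by (auto simp: path_cover_def)
      then have "r = p" using path_cover_same[OF pc r(1) p(1)] path_arcs_verts jp by blast
      then show False using path_arcs_ends(2)[OF r(2)] p pc by (auto simp: path_cover_def)
    qed
    then show ?thesis using i by blast
  qed
qed

text \<open>This is the situation after an inclusion with three rows left. Neither path may be
  closed on its own, so both missing arcs are forced and \<open>completion\<close> is well
  defined.\<close>

lemma completion_two_paths:
  assumes pc: "path_cover n {p, q} P" and pq: "p \<noteq> q"
  shows "hamiltonian_circuit n (completion n P)"
    and "\<And>H. hamiltonian_circuit n H \<Longrightarrow> P \<subseteq> H \<Longrightarrow> completion n P = H"
proof -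
  have ne: "p \<noteq> []" "q \<noteq> []" and disj: "set p \<inter> set q = {}" and d: "distinct p" "distinct q"
    and V: "set p \<union> set q = {1..n}" and P: "P = path_arcs p \<union> path_arcs q"
    using assms by (auto simp: path_cover_def)
  define K where "K = circuit (p @ q)"
  have K: "K = insert (last q, hd p) (insert (last p, hd q) P)"
    using ne by (simp add: K_def circuit_eq_path path_arcs_append P)
  have ham: "hamiltonian_circuit n K"
    using d disj V by (auto simp: hamiltonian_circuit_iff K_def intro!: exI[of _ "p @ q"])
  have uniq: "H = K" if H: "hamiltonian_circuit n H" "P \<subseteq> H" for H
  proof -
    have notp: "(last p, hd p) \<notin> H" using tour_no_subtour[OF H(1) pc H(2), of p q] pq by simp
    have notq: "(last q, hd q) \<notin> H" using tour_no_subtour[OF H(1) pc H(2), of q p] pq by simp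
    have "H - P \<subseteq> {last p, last q} \<times> {hd p, hd q}"
      "\<exists>j. (last p, j) \<in> H - P" "\<exists>j. (last q, j) \<in> H - P"
      using tour_diff_matching[OF H(1) pc H(2)] by auto
    then have "H - P = {(last p, hd q), (last q, hd p)}" using notp notq by blast
    then show ?thesis using K H(2) by blast
  qed
  have "completion n P = K"
    unfolding completion_def using ham uniq K by (intro the_equality) blast+
  then show "hamiltonian_circuit n (completion n P)"
    and "\<And>H. hamiltonian_circuit n H \<Longrightarrow> P \<subseteq> H \<Longrightarrow> completion n P = H"
    using ham uniq by simp_all
qed


section \<open>Numerical order on symbolic values and the outcomes of tests\<close>

section \<open>Values and tests\<close>

lemma inner_add: "inner n (f + g) C = inner n f C + inner n g C"
  by (simp add: inner_def algebra_simps sum.distrib)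

lemma inner_diff: "inner n (f - g) C = inner n f C - inner n g C"
  by (simp add: inner_def algebra_simps sum_subtractf)

lemma inner_zero [simp]: "inner n 0 C = 0"
  by (simp add: inner_def)

lemma inner_single:
  assumes "a \<in> arcs n"
  shows "inner n (indicator {a}) C = C a"
proof -
  have "inner n (indicator {a}) C = (\<Sum>b\<in>arcs n. if b = a then C b else 0)"
    unfolding inner_def by (intro sum.cong) (simp_all add: indicator_def)
  then show ?thesis using assms by (simp add: finite_arcs)
qed

text \<open>The junk value \<open>val_of n C Inf = 0\<close> is only ever used for finite entries.\<close>

fun val_of :: "nat \<Rightarrow> (arc \<Rightarrow> int) \<Rightarrow> val \<Rightarrow> int" where
  "val_of n C (Lin f) = inner n f C"
| "val_of n C Inf = 0"

fun val_le :: "nat \<Rightarrow> (arc \<Rightarrow> int) \<Rightarrow> val \<Rightarrow> val \<Rightarrow> bool" where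
  "val_le n C u Inf = True"
| "val_le n C Inf (Lin g) = False"
| "val_le n C (Lin f) (Lin g) = (inner n f C \<le> inner n g C)"

lemma val_le_refl [simp]: "val_le n C u u"
  by (cases u) auto

lemma val_le_trans: "val_le n C u v \<Longrightarrow> val_le n C v w \<Longrightarrow> val_le n C u w"
  by (cases u; cases v; cases w) auto

lemma val_le_linear: "val_le n C u v \<or> val_le n C v u"
  by (cases u; cases v) auto

text \<open>Formally identical forms make no exception: the fixed outcome assigned to them agrees
  with the comparison.\<close>

lemma fst_test_gt: "fst (test_gt n C u v h) \<longleftrightarrow> \<not> val_le n C u v"
  by (cases u; cases v) (auto simp: Let_def inner_diff)

lemma fst_test_ge: "fst (test_ge n C u v h) \<longleftrightarrow> val_le n C v u"
  by (cases u; cases v) (auto simp: Let_def inner_diff)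

lemma fst_test_zero: "fst (test_zero n C v h) \<longleftrightarrow> val_le n C v (Lin 0)"
  using fst_test_gt[of n C v "Lin 0" h] by (auto simp: test_zero_def split: prod.splits)

lemma vsub_finite:
  assumes "u \<noteq> Inf" and "v \<noteq> Inf"
  shows "vsub u v \<noteq> Inf" and "val_of n C (vsub u v) = val_of n C u - val_of n C v"
  using assms by (cases u; cases v; simp add: inner_diff)+

lemma vadd_finite:
  assumes "u \<noteq> Inf" and "v \<noteq> Inf"
  shows "vadd u v \<noteq> Inf" and "val_of n C (vadd u v) = val_of n C u + val_of n C v"
  using assms by (cases u; cases v; simp add: inner_add)+

lemma vadd_not_Inf: "vadd u v \<noteq> Inf \<longleftrightarrow> u \<noteq> Inf \<and> v \<noteq> Inf"
  by (cases u; cases v) auto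

text \<open>Names the body of the fold in \<open>find_min\<close>, for inductions over it.\<close>

definition min_step :: "nat \<Rightarrow> (arc \<Rightarrow> int) \<Rightarrow> val \<Rightarrow> val \<times> history \<Rightarrow> val \<times> history" where
  "min_step n C v = (\<lambda>(m, h). let (p, h) = test_gt n C m v h in (if p then v else m, h))"

lemma find_min_fold: "find_min n C vs h = fold (min_step n C) vs (Inf, h)"
  by (simp add: find_min_def min_step_def[abs_def])

lemma fst_min_step: "fst (min_step n C v st) = (if val_le n C (fst st) v then fst st else v)"
  using fst_test_gt[of n C "fst st" v "snd st"]
  by (auto simp: min_step_def split: prod.splits)

lemma fold_min_step:
  "fst (fold (min_step n C) vs st) \<in> insert (fst st) (set vs) \<and>
   (\<forall>v\<in>insert (fst st) (set vs). val_le n C (fst (fold (min_step n C) vs st)) v)"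
proof (induction vs arbitrary: st)
  case (Cons v vs)
  let ?st = "min_step n C v st"
  let ?m = "fst (fold (min_step n C) vs ?st)"
  have IH: "?m \<in> insert (fst ?st) (set vs)" "\<forall>u\<in>set vs. val_le n C ?m u"
      "val_le n C ?m (fst ?st)"
    using Cons[of ?st] by simp_all
  have "val_le n C (fst ?st) v" "val_le n C (fst ?st) (fst st)" and in_st: "fst ?st \<in> {v, fst st}"
    using val_le_linear[of n C "fst st" v] by (auto simp: fst_min_step)
  then have "val_le n C ?m v" "val_le n C ?m (fst st)"
    using IH(3) by (blast intro: val_le_trans)+
  moreover have "?m \<in> {v, fst st} \<union> set vs"
    using IH(1) in_st by auto
  ultimately show ?case
    using IH(2) by auto
qed simp

lemma find_min_in: "fst (find_min n C vs h) \<noteq> Inf \<Longrightarrow> fst (find_min n C vs h) \<in> set vs"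
  using fold_min_step[of n C vs "(Inf, h)"] by (auto simp: find_min_fold)

lemma find_min_le: "v \<in> set vs \<Longrightarrow> val_le n C (fst (find_min n C vs h)) v"
  using fold_min_step[of n C vs "(Inf, h)"] by (auto simp: find_min_fold)

lemma find_min_nonneg:
  assumes "\<forall>v\<in>set vs. val_le n C (Lin 0) v"
  shows "val_le n C (Lin 0) (fst (find_min n C vs h))"
  using find_min_in[of n C vs h] assms by (cases "fst (find_min n C vs h) = Inf") auto


section \<open>Monotonicity of the record of tests\<close>

section \<open>Histories only grow\<close>

declare branch_bound.simps [simp del]

lemma prefix_test_gt: "prefix h (snd (test_gt n C u v h))"
  by (cases u; cases v) (auto simp: Let_def)

lemma prefix_test_ge: "prefix h (snd (test_ge n C u v h))"
  by (cases u; cases v) (auto simp: Let_def)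

lemma prefix_test_zero: "prefix h (snd (test_zero n C v h))"
  using prefix_test_gt[of h n C v "Lin 0"] by (auto simp: test_zero_def split: prod.splits)

lemma prefix_test_weight: "prefix h (snd (test_weight n C v w h))"
  by (cases w; cases v) (auto simp: prefix_test_gt simp del: test_gt.simps)

lemma prefix_min_step: "prefix (snd st) (snd (min_step n C v st))"
  using prefix_test_gt[of "snd st" n C "fst st" v]
  by (auto simp: min_step_def split: prod.splits)

text \<open>The projection \<open>f\<close> is a parameter because the record sits at different
  places in the states of the various loops.\<close>

lemma prefix_fold:
  assumes "\<And>x st. prefix (f st) (f (g x st))"
  shows "prefix (f st) (f (fold g xs st))"
proof (induction xs arbitrary: st)
  case (Cons x xs)
  then show ?case using assms[of st x] by (simp add: prefix_order.trans)
qed simp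

lemma prefix_find_min: "prefix h (snd (find_min n C vs h))"
  using prefix_fold[of snd "min_step n C" "(Inf, h)" vs] prefix_min_step
  by (auto simp: find_min_fold)

lemma prefix_reduce_row: "prefix (snd (snd st)) (snd (snd (reduce_row n C J i st)))"
proof (cases st)
  case (fields M s h)
  then show ?thesis
    using prefix_find_min[of h n C "map (M i) J"]
    by (auto simp: reduce_row_def split: prod.splits)
qed

lemma prefix_reduce_col: "prefix (snd (snd st)) (snd (snd (reduce_col n C I j st)))"
proof (cases st)
  case (fields M s h)
  then show ?thesis
    using prefix_find_min[of h n C "map (\<lambda>i. M i j) I"]
    by (auto simp: reduce_col_def split: prod.splits)
qed

text \<open>The critical node lies inside the row loop, so the record after an initial segment
  \<open>is\<close> of the rows has to survive the later rows and the columns.\<close>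

lemma prefix_rows_cols:
  "prefix (snd (snd (fold (reduce_row n C J) is st))) (snd (snd (fold (reduce_col n C I) js
     (fold (reduce_row n C J) (is @ is') st))))"
proof -
  let ?f = "\<lambda>st :: matrix \<times> val \<times> history. snd (snd st)"
  have "prefix (?f (fold (reduce_row n C J) is st)) (?f (fold (reduce_row n C J) is' (fold (reduce_row n C J) is st)))"
    by (rule prefix_fold[where f = ?f]) (rule prefix_reduce_row)
  also have "prefix \<dots> (?f (fold (reduce_col n C I) js (fold (reduce_row n C J) is' (fold (reduce_row n C J) is st))))"
    by (rule prefix_fold[where f = ?f]) (rule prefix_reduce_col)
  finally show ?thesis by simp
qed

lemma prefix_reduction: "prefix h (snd (snd (reduction n C I J M s h)))"
  using prefix_rows_cols[of n C J "[]" "(M, s, h)" I J I] by (simp add: reduction_def)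

lemma prefix_choose_step: "prefix (snd st) (snd (choose_step n C I J M a st))"
proof -
  obtain i j where a: "a = (i, j)" by (cases a)
  obtain b h where st: "st = (b, h)" by (cases st)
  obtain z h1 where z: "test_zero n C (M i j) h = (z, h1)" by force
  obtain m h2 where m: "find_min n C (map (\<lambda>t. M i t) (removeAll j J)) h1 = (m, h2)" by force
  obtain k h3 where k: "find_min n C (map (\<lambda>t. M t j) (removeAll i I)) h2 = (k, h3)" by force
  obtain p h4 where p: "test_weight n C (vadd m k) (map_option fst b) h3 = (p, h4)" by force
  have "prefix h h1" "prefix h1 h2" "prefix h2 h3" "prefix h3 h4"
    using prefix_test_zero[of h n C "M i j"] prefix_find_min[of h1 n C "map (\<lambda>t. M i t) (removeAll j J)"]
      prefix_find_min[of h2 n C "map (\<lambda>t. M t j) (removeAll i I)"]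
      prefix_test_weight[of h3 n C "vadd m k" "map_option fst b"] z m k p by simp_all
  then have "prefix h h1" "prefix h h4"
    by (blast intro: prefix_order.trans)+
  then show ?thesis
    by (auto simp: a st choose_step_def z m k p)
qed

lemma prefix_choose_arc: "prefix h (snd (choose_arc n C I J M h))"
  using prefix_fold[of snd "choose_step n C I J M" "(None, h)" "List.product I J"] prefix_choose_step
  by (auto simp: choose_arc_def split: prod.splits)

text \<open>Lets inductions run on the number of finite entries alone: the inclusion branch deletes
  the row and column of the chosen finite entry and otherwise only makes an entry infinite.\<close>

lemma finite_entries_less_sub:
  assumes "(M, s, h1) = reduction n C I J M0 s0 h0" and "(Some (i, j), h3) = choose_arc n C I J M h2"
  shows "card (finite_entries (removeAll i I) (removeAll j J) (set_entry M k l Inf))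
    < card (finite_entries I J M0)"
proof -
  have "finite (finite_entries I J (set_entry M i j Inf))"
    by (rule finite_subset[of _ "set I \<times> set J"]) (auto simp: finite_entries_def)
  then have "card (finite_entries (removeAll i I) (removeAll j J) (set_entry M k l Inf))
      \<le> card (finite_entries I J (set_entry M i j Inf))"
    by (rule card_mono) (auto simp: finite_entries_def set_entry_def split: if_splits)
  also have "\<dots> < card (finite_entries I J M0)"
    by (rule finite_entries_less[OF assms])
  finally show ?thesis .
qed

text \<open>The global state between the two branches; isolating it gives both cases of the
  inclusion step the same exclusion call.\<close>

definition after_inclusion ::
  "nat \<Rightarrow> (arc \<Rightarrow> int) \<Rightarrow> nat list \<Rightarrow> nat list \<Rightarrow> matrix \<Rightarrow> arc set \<Rightarrow> val \<Rightarrow> nat \<Rightarrow> nat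
     \<Rightarrow> arc set \<times> val \<times> history \<Rightarrow> arc set \<times> val \<times> history" where
  "after_inclusion n C I J M P s i j = (\<lambda>(H, l, h).
     if length I = 3 then
       (let H' = completion n (insert (i, j) P);
            (p, h4) = test_gt n C l (Lin (indicator H')) h
        in if p then (H', Lin (indicator H'), h4) else (H, l, h4))
     else
       (let vs = maximal_path (insert (i, j) P) (i, j)
        in branch_bound n C (removeAll i I) (removeAll j J)
             (set_entry M (last vs) (hd vs) Inf) (insert (i, j) P) s (H, l, h)))"

lemma branch_bound_branch:
  assumes "reduction n C I J M0 s0 h = (M, s, h1)" and "test_ge n C s l h1 = (False, h2)"
    and "choose_arc n C I J M h2 = (Some (i, j), h3)"
  shows "branch_bound n C I J M0 P s0 (H, l, h)
    = branch_bound n C I J (set_entry M i j Inf) P s (after_inclusion n C I J M P s i j (H, l, h3))"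
  by (subst branch_bound.simps) (simp add: assms after_inclusion_def)

text \<open>Stronger than growth of \<open>h\<close>: the tests of the first reduction already open
  the final record. Composed with \<open>prefix_reduction\<close>, the induction hypothesis gives
  plain growth for the recursive calls.\<close>

lemma prefix_reduction_branch_bound:
  "prefix (snd (snd (reduction n C I J M0 s0 h))) (snd (snd (branch_bound n C I J M0 P s0 (H, l, h))))"
proof (induction "card (finite_entries I J M0)" arbitrary: I J M0 P s0 H l h rule: less_induct)
  case less
  have IH: "prefix h' (snd (snd (branch_bound n C I' J' M' P' s' (H', l', h'))))"
    if "card (finite_entries I' J' M') < card (finite_entries I J M0)" for I' J' M' P' s' H' l' h'
    using prefix_reduction less[OF that] by (rule prefix_order.trans)
  obtain M s h1 where red: "reduction n C I J M0 s0 h = (M, s, h1)" by (metis prod_cases3)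
  obtain stop h2 where stop: "test_ge n C s l h1 = (stop, h2)" by force
  obtain c h3 where ca: "choose_arc n C I J M h2 = (c, h3)" by force
  have "prefix h1 h2" "prefix h2 h3"
    using prefix_test_ge[of h1 n C s l] prefix_choose_arc[of h2 n C I J M] stop ca by simp_all
  then have h3: "prefix h1 h2" "prefix h1 h3"
    by (blast intro: prefix_order.trans)+
  show ?case
  proof (cases "stop \<or> c = None")
    case True
    then show ?thesis
      using h3 by (subst branch_bound.simps) (auto simp: red stop ca)
  next
    case False
    then obtain i j where c: "c = Some (i, j)" and ns: "\<not> stop" by auto
    let ?st = "after_inclusion n C I J M P s i j (H, l, h3)"
    have bb: "branch_bound n C I J M0 P s0 (H, l, h)
        = branch_bound n C I J (set_entry M i j Inf) P s ?st"
      using branch_bound_branch[OF red _ ca[unfolded c]] stop ns by simp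
    have "prefix h3 (snd (snd ?st))"
    proof (cases "length I = 3")
      case True
      then show ?thesis
        using prefix_test_gt[of h3 n C l "Lin (indicator (completion n (insert (i, j) P)))"]
        by (auto simp: after_inclusion_def Let_def split: prod.splits simp del: test_gt.simps)
    next
      case False
      then show ?thesis
        using IH[OF finite_entries_less_sub[OF red[symmetric] ca[unfolded c, symmetric]]]
        by (simp add: after_inclusion_def Let_def)
    qed
    moreover have "prefix (snd (snd st)) (snd (snd (branch_bound n C I J (set_entry M i j Inf) P s st)))" for st
      using IH[OF finite_entries_less[OF red[symmetric] ca[unfolded c, symmetric]]]
      by (cases st) simp
    ultimately have "prefix h1 (snd (snd (branch_bound n C I J (set_entry M i j Inf) P s ?st)))"
      using h3(2) by (blast intro: prefix_order.trans)
    then show ?thesis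
      by (simp add: bb red)
  qed
qed


section \<open>Reduction preserves tour lengths and leaves a nonnegative matrix\<close>

section \<open>Reduction\<close>

text \<open>Perfect matching of rows with columns; applied to \<open>T - P\<close>, the undecided
  arcs of a tour \<open>T\<close>.\<close>

definition matching :: "nat set \<Rightarrow> nat set \<Rightarrow> arc set \<Rightarrow> bool" where
  "matching I J A \<longleftrightarrow> A \<subseteq> I \<times> J \<and> finite A \<and> (\<forall>i\<in>I. \<exists>!j. (i, j) \<in> A) \<and> (\<forall>j\<in>J. \<exists>!i. (i, j) \<in> A)"

definition feasible :: "arc set \<Rightarrow> matrix \<Rightarrow> val \<Rightarrow> bool" where
  "feasible A M s \<longleftrightarrow> s \<noteq> Inf \<and> (\<forall>(i, j)\<in>A. M i j \<noteq> Inf)"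

text \<open>The invariant quantity: for the tours of a subproblem it stays equal to the true
  length.\<close>

definition residual_length :: "nat \<Rightarrow> (arc \<Rightarrow> int) \<Rightarrow> arc set \<Rightarrow> matrix \<Rightarrow> val \<Rightarrow> int" where
  "residual_length n C A M s = val_of n C s + (\<Sum>(i, j)\<in>A. val_of n C (M i j))"

lemma feasible_cong:
  assumes "\<And>i j. (i, j) \<in> A \<Longrightarrow> M i j = M' i j"
  shows "feasible A M s = feasible A M' s"
  unfolding feasible_def using assms by (intro conj_cong ball_cong refl) auto

lemma residual_length_cong:
  assumes "\<And>i j. (i, j) \<in> A \<Longrightarrow> M i j = M' i j"
  shows "residual_length n C A M s = residual_length n C A M' s"
  unfolding residual_length_def using assms by (intro arg_cong2[where f = plus] sum.cong refl) auto

text \<open>\<open>R\<close> stands for a row or a column. It meets \<open>A\<close> in a single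
  arc, so what is taken from that entry is what \<open>s\<close> gains; being bounded by this finite
  entry, \<open>m\<close> is finite.\<close>

lemma subtract_line:
  assumes "finite A" and line: "A \<inter> R = {(i, j)}" and f: "feasible A M s"
    and m: "val_le n C m (M i j)"
    and M': "M' = (\<lambda>r c. if (r, c) \<in> R then vsub (M r c) m else M r c)"
  shows "feasible A M' (vadd s m) \<and> residual_length n C A M' (vadd s m) = residual_length n C A M s"
proof -
  have ij: "(i, j) \<in> A" "(i, j) \<in> R" using line by auto
  then have "M i j \<noteq> Inf" using f by (auto simp: feasible_def)
  then have mf: "m \<noteq> Inf" using m by (cases m; cases "M i j") auto
  have sf: "s \<noteq> Inf" using f by (simp add: feasible_def)
  have "feasible A M' (vadd s m)"
    using f mf by (auto simp: feasible_def M' vadd_finite vsub_finite)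
  moreover have "(\<Sum>(r, c)\<in>A. val_of n C (M' r c))
      = (\<Sum>(r, c)\<in>A. val_of n C (M r c)) - val_of n C m"
  proof -
    have "(\<Sum>(r, c)\<in>A. val_of n C (M' r c))
        = val_of n C (M' i j) + (\<Sum>(r, c)\<in>A - {(i, j)}. val_of n C (M' r c))"
      using sum.remove[OF assms(1) ij(1), of "\<lambda>(r, c). val_of n C (M' r c)"] by simp
    also have "(\<Sum>(r, c)\<in>A - {(i, j)}. val_of n C (M' r c))
        = (\<Sum>(r, c)\<in>A - {(i, j)}. val_of n C (M r c))"
    proof (rule sum.cong)
      fix a assume "a \<in> A - {(i, j)}"
      then have "a \<notin> R" using line by blast
      then show "(case a of (r, c) \<Rightarrow> val_of n C (M' r c)) = (case a of (r, c) \<Rightarrow> val_of n C (M r c))"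
        by (cases a) (simp add: M')
    qed simp
    also have "val_of n C (M' i j) = val_of n C (M i j) - val_of n C m"
      using ij(2) \<open>M i j \<noteq> Inf\<close> mf by (simp add: M' vsub_finite)
    finally show ?thesis
      using sum.remove[OF assms(1) ij(1), of "\<lambda>(r, c). val_of n C (M r c)"] by simp
  qed
  ultimately show ?thesis
    using sf mf by (simp add: residual_length_def vadd_finite)
qed

lemma reduce_row_eq:
  "reduce_row n C J i (M, s, h) =
     (\<lambda>r c. if r = i \<and> c \<in> set J then vsub (M r c) (fst (find_min n C (map (M i) J) h)) else M r c,
      vadd s (fst (find_min n C (map (M i) J) h)), snd (find_min n C (map (M i) J) h))"
  by (cases "find_min n C (map (M i) J) h") (simp add: reduce_row_def cong: if_cong)

lemma reduce_col_eq:
  "reduce_col n C I j (M, s, h) =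
     (\<lambda>r c. if c = j \<and> r \<in> set I then vsub (M r c) (fst (find_min n C (map (\<lambda>i. M i j) I) h)) else M r c,
      vadd s (fst (find_min n C (map (\<lambda>i. M i j) I) h)), snd (find_min n C (map (\<lambda>i. M i j) I) h))"
  by (cases "find_min n C (map (\<lambda>i. M i j) I) h") (simp add: reduce_col_def cong: if_cong)

lemma reduce_row_total:
  assumes A: "matching (set I) (set J) A" and i: "i \<in> set I" and f: "feasible A M s"
    and red: "reduce_row n C J i (M, s, h) = (M', s', h')"
  shows "feasible A M' s' \<and> residual_length n C A M' s' = residual_length n C A M s"
proof -
  let ?m = "fst (find_min n C (map (M i) J) h)"
  have ex: "\<exists>!j. (i, j) \<in> A" and AJ: "A \<subseteq> set I \<times> set J"
    using A i by (simp_all add: matching_def)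
  from ex obtain j where j: "(i, j) \<in> A" "\<forall>k. (i, k) \<in> A \<longrightarrow> k = j"
    by (rule ex1E)
  have jJ: "j \<in> set J" using j(1) AJ by auto
  have line: "A \<inter> ({i} \<times> set J) = {(i, j)}"
  proof (intro equalityI subsetI)
    fix a assume "a \<in> A \<inter> ({i} \<times> set J)"
    then obtain k where "a = (i, k)" "(i, k) \<in> A" by auto
    then show "a \<in> {(i, j)}" using j(2) by simp
  qed (use j(1) jJ in simp)
  have m: "val_le n C ?m (M i j)" using jJ by (simp add: find_min_le)
  have "M' = (\<lambda>r c. if r = i \<and> c \<in> set J then vsub (M r c) ?m else M r c)" and s': "s' = vadd s ?m"
    using red by (simp_all add: reduce_row_eq)
  then have M': "M' = (\<lambda>r c. if (r, c) \<in> {i} \<times> set J then vsub (M r c) ?m else M r c)"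
    by simp
  have "finite A" using A by (simp add: matching_def)
  then show ?thesis
    unfolding s' by (rule subtract_line[OF _ line f m M'])
qed

lemma reduce_col_total:
  assumes A: "matching (set I) (set J) A" and j: "j \<in> set J" and f: "feasible A M s"
    and red: "reduce_col n C I j (M, s, h) = (M', s', h')"
  shows "feasible A M' s' \<and> residual_length n C A M' s' = residual_length n C A M s"
proof -
  let ?m = "fst (find_min n C (map (\<lambda>i. M i j) I) h)"
  have ex: "\<exists>!i. (i, j) \<in> A" and AI: "A \<subseteq> set I \<times> set J"
    using A j by (simp_all add: matching_def)
  from ex obtain i where i: "(i, j) \<in> A" "\<forall>k. (k, j) \<in> A \<longrightarrow> k = i"
    by (rule ex1E)
  have iI: "i \<in> set I" using i(1) AI by auto
  have line: "A \<inter> (set I \<times> {j}) = {(i, j)}"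
  proof (intro equalityI subsetI)
    fix a assume "a \<in> A \<inter> (set I \<times> {j})"
    then obtain k where "a = (k, j)" "(k, j) \<in> A" by auto
    then show "a \<in> {(i, j)}" using i(2) by simp
  qed (use i(1) iI in simp)
  have m: "val_le n C ?m (M i j)" using iI by (simp add: find_min_le)
  have "M' = (\<lambda>r c. if c = j \<and> r \<in> set I then vsub (M r c) ?m else M r c)" and s': "s' = vadd s ?m"
    using red by (simp_all add: reduce_col_eq)
  then have M': "M' = (\<lambda>r c. if (r, c) \<in> set I \<times> {j} then vsub (M r c) ?m else M r c)"
    by (simp add: conj_commute)
  have "finite A" using A by (simp add: matching_def)
  then show ?thesis
    unfolding s' by (rule subtract_line[OF _ line f m M'])
qed

lemma fold_total:
  assumes step: "\<And>x M s h M' s' h'. x \<in> set xs \<Longrightarrow> feasible A M s \<Longrightarrow> g x (M, s, h) = (M', s', h')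
      \<Longrightarrow> feasible A M' s' \<and> residual_length n C A M' s' = residual_length n C A M s"
    and "feasible A M s" and "fold g xs (M, s, h) = (M', s', h')"
  shows "feasible A M' s' \<and> residual_length n C A M' s' = residual_length n C A M s"
  using assms
proof (induction xs arbitrary: M s h)
  case (Cons x xs)
  obtain M1 s1 h1 where 1: "g x (M, s, h) = (M1, s1, h1)" by (metis prod_cases3)
  have 2: "feasible A M1 s1 \<and> residual_length n C A M1 s1 = residual_length n C A M s"
    by (rule Cons.prems(1)[OF _ Cons.prems(2) 1]) simp
  moreover have "feasible A M' s' \<and> residual_length n C A M' s' = residual_length n C A M1 s1"
  proof (rule Cons.IH)
    show "feasible A M1 s1" using 2 by simp
    show "fold g xs (M1, s1, h1) = (M', s', h')" using 1 Cons.prems(3) by simp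
    show "feasible A M2 s2 \<and> residual_length n C A M2 s2 = residual_length n C A M s"
      if "y \<in> set xs" "feasible A M s" "g y (M, s, h) = (M2, s2, h2)" for y M s h M2 s2 h2
      using that by (intro Cons.prems(1)) auto
  qed
  ultimately show ?case by simp
qed simp

lemma reduction_total:
  assumes A: "matching (set I) (set J) A" and f: "feasible A M s"
    and red: "reduction n C I J M s h = (M', s', h')"
  shows "feasible A M' s' \<and> residual_length n C A M' s' = residual_length n C A M s"
proof -
  obtain M1 s1 h1 where 1: "fold (reduce_row n C J) I (M, s, h) = (M1, s1, h1)"
    by (metis prod_cases3)
  have rows: "feasible A M1 s1 \<and> residual_length n C A M1 s1 = residual_length n C A M s"
    using reduce_row_total[OF A] f 1 by (rule fold_total)
  have "fold (reduce_col n C I) J (M1, s1, h1) = (M', s', h')"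
    using red 1 by (simp add: reduction_def)
  with reduce_col_total[OF A] rows[THEN conjunct1]
  have "feasible A M' s' \<and> residual_length n C A M' s' = residual_length n C A M1 s1"
    by (rule fold_total)
  then show ?thesis
    using rows by simp
qed

text \<open>Stated for columns because they are reduced last: together they give a nonnegative
  matrix, and each of them a zero. A column of infinite entries makes the sum infinite, hence the
  guard on \<open>s\<close>.\<close>

definition reduced_col :: "nat \<Rightarrow> (arc \<Rightarrow> int) \<Rightarrow> nat list \<Rightarrow> matrix \<Rightarrow> val \<Rightarrow> nat \<Rightarrow> bool" where
  "reduced_col n C I M s j \<longleftrightarrow> (\<forall>i\<in>set I. val_le n C (Lin 0) (M i j)) \<and>
     (s \<noteq> Inf \<longrightarrow> (\<exists>i\<in>set I. M i j \<noteq> Inf \<and> val_le n C (M i j) (Lin 0)))"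

text \<open>A finite minimum is attained, which yields the zero. For other columns a finite new sum
  implies a finite old one, so the guard is inherited.\<close>

lemma reduce_col_reduced:
  assumes "reduce_col n C I j (M, s, h) = (M', s', h')"
  shows "reduced_col n C I M' s' j"
    and "k \<noteq> j \<Longrightarrow> reduced_col n C I M s k \<Longrightarrow> reduced_col n C I M' s' k"
proof -
  let ?m = "fst (find_min n C (map (\<lambda>i. M i j) I) h)"
  have M': "M' = (\<lambda>r c. if c = j \<and> r \<in> set I then vsub (M r c) ?m else M r c)" and s': "s' = vadd s ?m"
    using assms by (simp_all add: reduce_col_eq)
  have nonneg: "val_le n C (Lin 0) (vsub (M i j) ?m)" if "i \<in> set I" for i
  proof -
    have "val_le n C ?m (M i j)" using that by (simp add: find_min_le)
    then show ?thesis by (cases ?m; cases "M i j") (auto simp: inner_diff)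
  qed
  have zero: "\<exists>i\<in>set I. vsub (M i j) ?m = Lin 0" if "s' \<noteq> Inf"
  proof -
    have m: "?m \<noteq> Inf" using that by (simp add: s' vadd_not_Inf)
    then obtain i where "i \<in> set I" "?m = M i j"
      using find_min_in by fastforce
    then show ?thesis using m by (cases "M i j") (auto intro!: bexI[of _ i] simp: fun_eq_iff)
  qed
  show "reduced_col n C I M' s' j"
    unfolding reduced_col_def
  proof (intro conjI ballI impI)
    show "val_le n C (Lin 0) (M' i j)" if "i \<in> set I" for i
      using nonneg that by (simp add: M')
    show "\<exists>i\<in>set I. M' i j \<noteq> Inf \<and> val_le n C (M' i j) (Lin 0)" if fin: "s' \<noteq> Inf"
    proof -
      obtain i where "i \<in> set I" "vsub (M i j) ?m = Lin 0" using zero[OF fin] by blast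
      then show ?thesis by (intro bexI[of _ i]) (simp_all add: M')
    qed
  qed
  show "k \<noteq> j \<Longrightarrow> reduced_col n C I M s k \<Longrightarrow> reduced_col n C I M' s' k"
    by (auto simp: reduced_col_def M' s' vadd_not_Inf)
qed

lemma reduction_reduced:
  assumes red: "reduction n C I J M s h = (M', s', h')" and j: "j \<in> set J"
  shows "reduced_col n C I M' s' j"
proof -
  have cols: "\<forall>j\<in>set js. reduced_col n C I (fst st') (fst (snd st')) j"
    if "st' = fold (reduce_col n C I) js st" for js st st'
    using that
  proof (induction js arbitrary: st' rule: rev_induct)
    case (snoc x js)
    let ?t = "fold (reduce_col n C I) js st"
    obtain M1 s1 h1 where 1: "?t = (M1, s1, h1)" by (metis prod_cases3)
    obtain M2 s2 h2 where 2: "reduce_col n C I x (M1, s1, h1) = (M2, s2, h2)" by (metis prod_cases3)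
    have "\<forall>j\<in>set js. reduced_col n C I M1 s1 j" using snoc.IH[of ?t] 1 by simp
    then have "\<forall>j\<in>set (js @ [x]). reduced_col n C I M2 s2 j"
      using reduce_col_reduced[OF 2] by (metis rotate1.simps(2) set_ConsD set_rotate1)
    then show ?case using snoc.prems 1 2 by simp
  qed simp
  show ?thesis using cols[OF refl, of J "fold (reduce_row n C J) I (M, s, h)"] red j
    by (simp add: reduction_def)
qed


section \<open>Existence of a branching arc, with zero entry\<close>

section \<open>The chosen arc\<close>

lemma choose_step_Some:
  assumes "fst st \<noteq> None" shows "fst (choose_step n C I J M a st) \<noteq> None"
  using assms by (auto simp: choose_step_def split: prod.splits)

lemma choose_step_zero:
  assumes nonneg: "\<forall>i\<in>set I. \<forall>j\<in>set J. val_le n C (Lin 0) (M i j)"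
    and ij: "i \<in> set I" "j \<in> set J" and zero: "val_le n C (M i j) (Lin 0)"
  shows "fst (choose_step n C I J M (i, j) st) \<noteq> None"
proof -
  obtain b h where st: "st = (b, h)" by (cases st)
  obtain z h1 where z: "test_zero n C (M i j) h = (z, h1)" by force
  obtain m h2 where m: "find_min n C (map (\<lambda>t. M i t) (removeAll j J)) h1 = (m, h2)" by force
  obtain k h3 where k: "find_min n C (map (\<lambda>t. M t j) (removeAll i I)) h2 = (k, h3)" by force
  obtain p h4 where p: "test_weight n C (vadd m k) (map_option fst b) h3 = (p, h4)" by force
  have z': "z" using fst_test_zero[of n C "M i j" h] z zero by simp
  have "val_le n C (Lin 0) m" "val_le n C (Lin 0) k"
    using find_min_nonneg[of "map (\<lambda>t. M i t) (removeAll j J)" n C h1]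
      find_min_nonneg[of "map (\<lambda>t. M t j) (removeAll i I)" n C h2] m k nonneg ij by auto
  \<comment> \<open>The first zero entry always wins: its weight is nonnegative or infinite and so
    exceeds the initial -1.\<close>
  then have init: "p" if "b = None"
    using p that by (cases m; cases k) (auto simp: inner_add)
  show ?thesis
  proof (cases b)
    case None
    then have "test_weight n C (vadd m k) None h3 = (p, h4)" "p" using p init by simp_all
    then show ?thesis using z' None by (simp add: choose_step_def st z m k)
  qed (simp add: choose_step_Some st del: not_None_eq)
qed

lemma choose_arc_exists:
  assumes nonneg: "\<forall>i\<in>set I. \<forall>j\<in>set J. val_le n C (Lin 0) (M i j)"
    and ij: "i \<in> set I" "j \<in> set J" and zero: "val_le n C (M i j) (Lin 0)"
  shows "fst (choose_arc n C I J M h) \<noteq> None"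
proof -
  have keep: "fst (fold (choose_step n C I J M) as st) \<noteq> None" if "fst st \<noteq> None" for as st
    using that by (induction as arbitrary: st) (simp_all add: choose_step_Some del: not_None_eq)
  have "(i, j) \<in> set (List.product I J)" using ij by simp
  then obtain xs ys where "List.product I J = xs @ (i, j) # ys" by (meson split_list)
  then have "fst (fold (choose_step n C I J M) (List.product I J) (None, h)) \<noteq> None"
    using keep choose_step_zero[OF assms] by simp
  then show ?thesis
    by (auto simp: choose_arc_def split: prod.splits)
qed

lemma choose_arc_zero:
  assumes "choose_arc n C I J M h = (Some (i, j), h')"
  shows "val_le n C (M i j) (Lin 0)"
proof -
  define ok where "ok = (\<lambda>b :: (val \<times> arc) option. \<forall>w i j. b = Some (w, (i, j)) \<longrightarrow> val_le n C (M i j) (Lin 0))"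
  have step: "ok (fst (choose_step n C I J M e st))" if "ok (fst st)" for e st
    using that fst_test_zero[of n C "M (fst e) (snd e)" "snd st"]
    by (auto simp: ok_def choose_step_def split: prod.splits if_splits)
  have "ok (fst (fold (choose_step n C I J M) es st))" if "ok (fst st)" for es st
    using that by (induction es arbitrary: st) (simp_all add: step)
  from this[of "(None, h)" "List.product I J"] show ?thesis
    using assms by (auto simp: ok_def choose_arc_def split: prod.splits)
qed


section \<open>Optimality of the output\<close>

section \<open>Correctness\<close>

definition incumbent :: "nat \<Rightarrow> arc set \<Rightarrow> val \<Rightarrow> bool" where
  "incumbent n H l \<longleftrightarrow> l = Inf \<or> hamiltonian_circuit n H \<and> l = Lin (indicator H)"

text \<open>\<open>F\<close> is the set of tours that the subproblem still has to account for: those containing \<open>P\<close> and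
  avoiding the arcs excluded by earlier branchings.\<close>

definition tours_at ::
  "nat \<Rightarrow> (arc \<Rightarrow> int) \<Rightarrow> matrix \<Rightarrow> arc set \<Rightarrow> val \<Rightarrow> arc set set \<Rightarrow> bool" where
  "tours_at n C M P s F \<longleftrightarrow> (\<forall>T\<in>F. hamiltonian_circuit n T \<and> P \<subseteq> T \<and>
     feasible (T - P) M s \<and> residual_length n C (T - P) M s = sum C T)"

lemma tour_matching:
  assumes "hamiltonian_circuit n T" and "P \<subseteq> T" and pc: "path_cover n Q P" and "2 \<le> n"
    and I: "set I = last ` Q" and J: "set J = hd ` Q"
  shows "matching (set I) (set J) (T - P)"
  unfolding matching_def
proof (intro conjI ballI ex_ex1I)
  note m = tour_diff_matching[OF assms(1) pc assms(2)]
  show "T - P \<subseteq> set I \<times> set J" using m(1) I J by simp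
  show "finite (T - P)"
    using finite_subset[OF tour_subset_arcs[OF assms(1,4)] finite_arcs] by simp
  show "\<exists>j. (i, j) \<in> T - P" if "i \<in> set I" for i using m(2) that I by simp
  show "\<exists>i. (i, j) \<in> T - P" if "j \<in> set J" for j using m(3) that J by simp
qed (use tour_succ_unique[OF assms(1)] tour_pred_unique[OF assms(1)] in blast)+

lemma path_cover_inj:
  assumes "path_cover n Q P"
  shows "inj_on last Q" and "inj_on hd Q"
proof -
  have ne: "p \<noteq> []" if "p \<in> Q" for p using assms that by (auto simp: path_cover_def)
  show "inj_on last Q"
    using path_cover_same[OF assms] ne by (intro inj_onI) (metis last_in_set)
  show "inj_on hd Q"
    using path_cover_same[OF assms] ne by (intro inj_onI) (metis hd_in_set)
qed

lemma set_entry_apply: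
  "set_entry M a b Inf x y = (if x = a \<and> y = b then Inf else M x y)"
  by (simp add: set_entry_def)

text \<open>Induction on the number of finite entries. Pruning is safe because, with nonnegative
  entries, \<open>sum\<close> bounds the length of every tour in \<open>F\<close> from below.
  Otherwise \<open>F\<close> is split according to the chosen arc, and each branch settles its part.
  The infinite closing entries keep the chosen arc from closing a path.\<close>

theorem branch_bound_correct:
  assumes "3 \<le> n" and "path_cover n Q P" and "distinct I" and "set I = last ` Q" and "set J = hd ` Q"
    and "3 \<le> length I" and "\<forall>p\<in>Q. M0 (last p) (hd p) = Inf"
    and "incumbent n H l" and "tours_at n C M0 P s0 F"
    and "branch_bound n C I J M0 P s0 (H, l, h) = (H', l', h')"
  shows "incumbent n H' l' \<and> val_le n C l' l \<and> (\<forall>T\<in>F. val_le n C l' (Lin (indicator T)))"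
  using assms(2-)
proof (induction "card (finite_entries I J M0)" arbitrary: I J M0 P s0 H l h Q F H' l' h'
    rule: less_induct)
  case less
  note pc = less.prems(1) and dI = less.prems(2) and I = less.prems(3) and J = less.prems(4)
    and len = less.prems(5) and nosub = less.prems(6) and inc = less.prems(7)
    and F = less.prems(8) and bb = less.prems(9)
  obtain M s h1 where red: "reduction n C I J M0 s0 h = (M, s, h1)" by (metis prod_cases3)
  obtain stop h2 where stop: "test_ge n C s l h1 = (stop, h2)" by force
  obtain c h3 where ca: "choose_arc n C I J M h2 = (c, h3)" by force
  have n2: "2 \<le> n" using assms(1) by simp
  have tm: "matching (set I) (set J) (T - P)" if "T \<in> F" for T
    using F that pc I J n2 by (intro tour_matching) (auto simp: tours_at_def)
  have FM: "tours_at n C M P s F"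
    unfolding tours_at_def using F reduction_total[OF tm _ red] by (auto simp: tours_at_def)
  have cols: "reduced_col n C I M s j" if "j \<in> set J" for j
    using reduction_reduced[OF red that] .
  then have nonneg: "\<forall>i\<in>set I. \<forall>j\<in>set J. val_le n C (Lin 0) (M i j)"
    by (auto simp: reduced_col_def)
  have nosubM: "M (last p) (hd p) = Inf" if "p \<in> Q" for p
  proof -
    have "(last p, hd p) \<notin> finite_entries I J M0"
      using nosub that by (auto simp: finite_entries_def)
    then have "(last p, hd p) \<notin> finite_entries I J M"
      using finite_entries_reduction[of I J n C M0 s0 h] by (auto simp: red)
    then show ?thesis using that I J by (auto simp: finite_entries_def)
  qed
  show ?case
  proof (cases stop)
    case True
    then have res: "H' = H" "l' = l"
      using bb by (subst (asm) branch_bound.simps; simp add: red stop)+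
    have ls: "val_le n C l s" using fst_test_ge[of n C s l h1] stop True by simp
    have "val_le n C l (Lin (indicator T))" if T: "T \<in> F" for T
    proof -
      have fT: "hamiltonian_circuit n T" "feasible (T - P) M s" "residual_length n C (T - P) M s = sum C T"
        using FM T by (auto simp: tours_at_def)
      have "0 \<le> val_of n C (M i j)" if "(i, j) \<in> T - P" for i j
      proof -
        have "val_le n C (Lin 0) (M i j)" using tm[OF T] that nonneg by (auto simp: matching_def)
        then show ?thesis by (cases "M i j") auto
      qed
      then have "0 \<le> (\<Sum>(i, j)\<in>T - P. val_of n C (M i j))" by (intro sum_nonneg) auto
      then have "val_of n C s \<le> sum C T" using fT(3) by (simp add: residual_length_def)
      moreover have "s \<noteq> Inf" using fT(2) by (simp add: feasible_def)
      ultimately show ?thesis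
        using ls inner_tour[OF fT(1) n2, of C] by (cases l; cases s) auto
    qed
    then show ?thesis using res inc by simp
  next
    case False
    then have "\<not> val_le n C l s" using fst_test_ge[of n C s l h1] stop by simp
    then have sfin: "s \<noteq> Inf" by auto
    have "set J \<noteq> {}" using I J len by auto
    then obtain j0 where j0: "j0 \<in> set J" by (meson ex_in_conv)
    then obtain i0 where "i0 \<in> set I" "val_le n C (M i0 j0) (Lin 0)"
      using cols[OF j0] sfin by (auto simp: reduced_col_def)
    then have "fst (choose_arc n C I J M h2) \<noteq> None"
      using choose_arc_exists nonneg j0 by blast
    then obtain i j where c: "c = Some (i, j)" using ca by auto
    have fin: "i \<in> set I" "j \<in> set J" "M i j \<noteq> Inf"
      using choose_arc_finite_entry ca c by (auto simp: finite_entries_def)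
    \<comment> \<open>The entry passed the zero test and the reduced matrix is nonnegative; hence
      including the arc leaves residual lengths unchanged.\<close>
    then have Mij: "val_of n C (M i j) = 0"
      using choose_arc_zero[of n C I J M h2 i j h3] ca c nonneg by (cases "M i j") force+
    obtain p q where p: "p \<in> Q" "i = last p" and q: "q \<in> Q" "j = hd q"
      using fin I J by auto
    \<comment> \<open>Within one path this would be the closing arc, whose entry is infinite, while
      the chosen entry is finite.\<close>
    have pq: "p \<noteq> q" using nosubM fin p q by auto
    define P' where "P' = insert (i, j) P"
    define Q' where "Q' = insert (p @ q) (Q - {p, q})"
    have pc': "path_cover n Q' P'"
      using path_cover_join[OF pc p(1) q(1) pq] by (simp add: P'_def Q'_def p q)
    have finQ: "finite Q" using pc by (simp add: path_cover_def)
    have ne: "p \<noteq> []" "q \<noteq> []" using pc p q by (auto simp: path_cover_def)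
    have card_Q: "card Q = length I"
      using card_image[OF path_cover_inj(1)[OF pc]] I distinct_card[OF dI] by simp
    have card_Q': "card Q' = length I - 1"
    proof -
      have "card Q' = Suc (card (Q - {p, q}))"
        using path_cover_join_notin[OF pc p(1) q(1) pq] finQ by (simp add: Q'_def)
      moreover have "card (Q - {p, q}) = card Q - 2"
        using finQ p q pq by (simp add: card_Diff_subset)
      ultimately show ?thesis using len card_Q by simp
    qed
    \<comment> \<open>At least two paths remain after the merge, so closing \<open>p @ q\<close>
      would create a subtour.\<close>
    have other: "\<exists>r\<in>Q'. r \<noteq> p @ q"
    proof (rule ccontr)
      assume "\<not> (\<exists>r\<in>Q'. r \<noteq> p @ q)"
      then have "Q' \<subseteq> {p @ q}" by blast
      then have "card Q' \<le> 1" using card_mono[of "{p @ q}" Q'] by simp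
      then show False using card_Q' len by simp
    qed
    have max: "maximal_path P' (i, j) = p @ q"
    proof (rule maximal_path_eq[OF pc'])
      show "p @ q \<in> Q'" by (simp add: Q'_def)
      show "(i, j) \<in> path_arcs (p @ q)" using ne by (simp add: path_arcs_append p q)
    qed
    let ?st = "after_inclusion n C I J M P s i j (H, l, h3)"
    have bb': "branch_bound n C I J (set_entry M i j Inf) P s ?st = (H', l', h')"
      using bb branch_bound_branch[OF red _ ca[unfolded c]] stop False by simp
    obtain H1 l1 h4 where st: "?st = (H1, l1, h4)" by (metis prod_cases3)
    define F1 where "F1 = {T \<in> F. (i, j) \<in> T}"
    define F2 where "F2 = {T \<in> F. (i, j) \<notin> T}"
    have "incumbent n H1 l1 \<and> val_le n C l1 l \<and> (\<forall>T\<in>F1. val_le n C l1 (Lin (indicator T)))"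
    proof (cases "length I = 3")
      case True
      have "card Q' = 2" using True card_Q' by simp
      moreover have "finite Q'" "p @ q \<in> Q'" using finQ by (simp_all add: Q'_def)
      ultimately obtain r where r: "Q' = {p @ q, r}" "p @ q \<noteq> r"
        by (elim card_2_iff[THEN iffD1, THEN exE] exE conjE) auto
      note comp = completion_two_paths[OF pc'[unfolded r(1)] r(2)]
      let ?K = "completion n P'"
      have "(H1, l1) = (if \<not> val_le n C l (Lin (indicator ?K)) then (?K, Lin (indicator ?K)) else (H, l))"
        using st True fst_test_gt[of n C l "Lin (indicator ?K)" h3]
        by (auto simp: after_inclusion_def P'_def Let_def split: prod.splits if_splits simp del: test_gt.simps)
      moreover have "T = ?K" if "T \<in> F1" for T
        using comp(2)[of T] that F by (auto simp: F1_def tours_at_def P'_def)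
      ultimately show ?thesis
        using inc comp(1) val_le_linear[of n C l "Lin (indicator ?K)"]
        by (auto simp: incumbent_def split: if_splits)
    next
      case False
      have st': "branch_bound n C (removeAll i I) (removeAll j J)
                 (set_entry M (last q) (hd p) Inf) P' s (H, l, h3) = (H1, l1, h4)"
        using st False
        by (simp add: after_inclusion_def max[unfolded P'_def] last_appendR[OF ne(2)] hd_append2[OF ne(1)]
            P'_def)
      have rI: "set (removeAll i I) = last ` Q'"
      proof -
        have "last ` (Q - {p}) = last ` Q - {last p}"
          using inj_on_image_set_diff[OF path_cover_inj(1)[OF pc], of Q "{p}"] p by simp
        moreover have "last ` Q' = last ` (Q - {p})"
          using q pq ne by (auto simp: Q'_def)
        ultimately show ?thesis using I p by simp
      qed
      have rJ: "set (removeAll j J) = hd ` Q'"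
      proof -
        have "hd ` (Q - {q}) = hd ` Q - {hd q}"
          using inj_on_image_set_diff[OF path_cover_inj(2)[OF pc], of Q "{q}"] q by simp
        moreover have "hd ` Q' = hd ` (Q - {q})"
          using p pq ne by (auto simp: Q'_def)
        ultimately show ?thesis using J q by simp
      qed
      have "length (removeAll i I) = length I - 1"
        using fin(1) dI by (simp add: distinct_remove1_removeAll[symmetric] length_remove1)
      then have rlen: "3 \<le> length (removeAll i I)" using len False by simp
      have rsub: "\<forall>r\<in>Q'. set_entry M (last q) (hd p) Inf (last r) (hd r) = Inf"
      proof
        fix r assume "r \<in> Q'"
        then have "r = p @ q \<or> r \<in> Q" by (auto simp: Q'_def)
        then show "set_entry M (last q) (hd p) Inf (last r) (hd r) = Inf"
          using nosubM[of r] ne by (elim disjE) (simp_all add: set_entry_apply)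
      qed
      have rF: "tours_at n C (set_entry M (last q) (hd p) Inf) P' s F1"
        unfolding tours_at_def
      proof
        fix T assume T: "T \<in> F1"
        then have fT: "hamiltonian_circuit n T" "P \<subseteq> T" "feasible (T - P) M s"
            "residual_length n C (T - P) M s = sum C T" "(i, j) \<in> T"
          using FM by (auto simp: tours_at_def F1_def)
        have P'T: "P' \<subseteq> T" using fT by (simp add: P'_def)
        obtain r where "r \<in> Q'" "r \<noteq> p @ q" using other by blast
        then have "(last (p @ q), hd (p @ q)) \<notin> T"
          by (intro tour_no_subtour[OF fT(1) pc' P'T]) (simp_all add: Q'_def)
        then have lk: "(last q, hd p) \<notin> T" using ne by simp
        have ijP: "(i, j) \<notin> P"
        proof
          assume "(i, j) \<in> P"
          then obtain r where r: "r \<in> Q" "(i, j) \<in> path_arcs r"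
            using pc by (auto simp: path_cover_def)
          moreover have "i \<in> set p" using p ne by simp
          ultimately have "r = p"
            using path_cover_same[OF pc r(1) p(1)] path_arcs_verts(1) by blast
          then show False using r path_arcs_ends(1)[OF r(2)] pc p by (auto simp: path_cover_def)
        qed
        have diff: "T - P' = (T - P) - {(i, j)}" by (auto simp: P'_def)
        \<comment> \<open>The entry set to infinity lies on no tour of \<open>F1\<close>.\<close>
        have eq: "set_entry M (last q) (hd p) Inf a b = M a b" if "(a, b) \<in> T" for a b
          using that lk by (auto simp: set_entry_def)
        have f': "feasible (T - P') (set_entry M (last q) (hd p) Inf) s"
          using fT(3) eq by (fastforce simp: feasible_def diff)
        have finT: "finite (T - P)"
          using tm[of T] T by (simp add: F1_def matching_def)
        have "(\<Sum>(a, b)\<in>T - P'. val_of n C (set_entry M (last q) (hd p) Inf a b))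
            = (\<Sum>(a, b)\<in>T - P'. val_of n C (M a b))"
          using eq by (intro sum.cong) auto
        also have "\<dots> = (\<Sum>(a, b)\<in>T - P. val_of n C (M a b))"
          using sum.remove[OF finT, of "(i, j)" "\<lambda>(a, b). val_of n C (M a b)"] ijP fT(5) Mij
          by (simp add: diff)
        finally have "residual_length n C (T - P') (set_entry M (last q) (hd p) Inf) s = sum C T"
          using fT(4) by (simp add: residual_length_def)
        then show "hamiltonian_circuit n T \<and> P' \<subseteq> T \<and>
            feasible (T - P') (set_entry M (last q) (hd p) Inf) s \<and>
            residual_length n C (T - P') (set_entry M (last q) (hd p) Inf) s = sum C T"
          using fT(1) P'T f' by blast
      qed
      show ?thesis
        by (rule less.hyps[OF finite_entries_less_sub[OF red[symmetric] ca[unfolded c, symmetric]]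
              pc' distinct_removeAll[OF dI] rI rJ rlen rsub inc rF st'])
    qed
    then have inc1: "incumbent n H1 l1" and l1: "val_le n C l1 l"
      and F1: "\<forall>T\<in>F1. val_le n C l1 (Lin (indicator T))" by simp_all
    have nosub2: "\<forall>r\<in>Q. set_entry M i j Inf (last r) (hd r) = Inf"
      using nosubM by (auto simp: set_entry_def)
    have tours2: "tours_at n C (set_entry M i j Inf) P s F2"
    proof -
      have eq: "set_entry M i j Inf a b = M a b" if "T \<in> F2" "(a, b) \<in> T - P" for a b T
        using that by (auto simp: set_entry_def F2_def)
      have "feasible (T - P) (set_entry M i j Inf) s = feasible (T - P) M s"
        "residual_length n C (T - P) (set_entry M i j Inf) s = residual_length n C (T - P) M s"
        if "T \<in> F2" for T
        using eq[OF that] by (rule feasible_cong residual_length_cong; blast)+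
      then show ?thesis
        using FM by (auto simp: tours_at_def F2_def)
    qed
    have "incumbent n H' l' \<and> val_le n C l' l1 \<and> (\<forall>T\<in>F2. val_le n C l' (Lin (indicator T)))"
      by (rule less.hyps[OF finite_entries_less[OF red[symmetric] ca[unfolded c, symmetric]]
            pc dI I J len nosub2 inc1 tours2 bb'[unfolded st]])
    moreover have "F = F1 \<union> F2" by (auto simp: F1_def F2_def)
    \<comment> \<open>The bounds for \<open>F1\<close> survive the second call because the incumbent
      value never increases.\<close>
    ultimately show ?thesis
      using l1 F1 val_le_trans by blast
  qed
qed

text \<open>At the root the cover consists of singletons, whose closing arcs are the infinite
  diagonal, \<open>F\<close> is the set of all tours, and the residual length is the length
  itself.\<close>

theorem algorithm_output_optimal:
  assumes "3 \<le> n"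
  shows "optimal n C (algorithm_output n C)"
proof -
  let ?V = "[1..<Suc n]"
  let ?Q = "(\<lambda>i. [i]) ` {1..n}"
  let ?F = "{T. hamiltonian_circuit n T}"
  have n2: "2 \<le> n" using assms by simp
  obtain H l h where run: "run n C = (H, l, h)" by (metis prod_cases3)
  have "tours_at n C input_matrix {} (Lin 0) ?F"
    unfolding tours_at_def
  proof
    fix T assume "T \<in> ?F"
    then have T: "hamiltonian_circuit n T" by simp
    have "input_matrix i j = Lin (indicator {(i, j)})" and "inner n (indicator {(i, j)}) C = C (i, j)"
      if "(i, j) \<in> T" for i j
    proof -
      have ij: "(i, j) \<in> arcs n" using tour_subset_arcs[OF T n2] that by blast
      then show "input_matrix i j = Lin (indicator {(i, j)})"
        by (auto simp: input_matrix_def arcs_def)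
      then show "inner n (indicator {(i, j)}) C = C (i, j)"
        using ij by (intro inner_single)
    qed
    then have "feasible T input_matrix (Lin 0)" "residual_length n C T input_matrix (Lin 0) = sum C T"
      by (auto simp: feasible_def residual_length_def intro!: sum.cong)
    then show "hamiltonian_circuit n T \<and> {} \<subseteq> T \<and> feasible (T - {}) input_matrix (Lin 0) \<and>
        residual_length n C (T - {}) input_matrix (Lin 0) = sum C T"
      using T by simp
  qed
  then have "incumbent n H l \<and> val_le n C l Inf \<and> (\<forall>T\<in>?F. val_le n C l (Lin (indicator T)))"
    using run assms path_cover_singletons[of n]
    by (intro branch_bound_correct[where Q = ?Q and I = ?V and J = ?V and ?M0.0 = input_matrix
          and P = "{}" and ?s0.0 = "Lin 0" and H = "{}" and h = "[]"])
      (auto simp: run_def incumbent_def input_matrix_def image_image)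
  then have inc: "incumbent n H l" and le: "\<And>T. hamiltonian_circuit n T \<Longrightarrow> val_le n C l (Lin (indicator T))"
    by simp_all
  \<comment> \<open>Some tour exists, so the final \<open>l\<close> is finite and therefore belongs
    to a recorded tour.\<close>
  have "hamiltonian_circuit n (circuit ?V)"
    by (auto simp: hamiltonian_circuit_iff intro!: exI[of _ ?V])
  then have "l \<noteq> Inf" using le by fastforce
  then have H: "hamiltonian_circuit n H" "l = Lin (indicator H)"
    using inc by (auto simp: incumbent_def)
  then show ?thesis
    using le run by (auto simp: optimal_def solutions_def algorithm_output_def)
qed


section \<open>Explicit beginning of the record\<close>

section \<open>Tests of the first row reductions\<close>

text \<open>\<open>scan C i j ks\<close>: the outcomes recorded while the minimum of row \<open>i\<close> of the input, currently at column \<open>j\<close>,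
  is compared with the entries in the columns \<open>ks\<close>.\<close>

fun scan :: "(arc \<Rightarrow> int) \<Rightarrow> nat \<Rightarrow> nat \<Rightarrow> nat list \<Rightarrow> history" where
  "scan C i j [] = []"
| "scan C i j (k # ks) =
     (C (i, j) > C (i, k)) # scan C i (if C (i, j) > C (i, k) then k else j) ks"

text \<open>Neither the infinite diagonal entry nor the first finite entry, met by the initial
  \<open>Inf\<close>, causes a counted test.\<close>

definition row_tests :: "(arc \<Rightarrow> int) \<Rightarrow> nat list \<Rightarrow> nat \<Rightarrow> history" where
  "row_tests C J i = (case removeAll i J of [] \<Rightarrow> [] | j # ks \<Rightarrow> scan C i j ks)"

lemma indicator_int_eq_iff: "(indicator A :: 'a \<Rightarrow> int) = indicator B \<longleftrightarrow> A = B"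
  by (metis indicator_simps(1) indicator_simps(2) subsetI subset_antisym zero_neq_one)

lemma test_gt_arcs:
  assumes "a \<in> arcs n" and "b \<in> arcs n" and "a \<noteq> b"
  shows "test_gt n C (Lin (indicator {a})) (Lin (indicator {b})) h = (C a > C b, h @ [C a > C b])"
  using assms by (simp add: indicator_int_eq_iff inner_diff inner_single Let_def)

lemma min_step_simps:
  "min_step n C Inf st = st"
  "min_step n C (Lin f) (Inf, h) = (Lin f, h)"
  by (cases st; cases "fst st"; simp add: min_step_def)+

lemma input_matrix_simps:
  "input_matrix i i = Inf"
  "i \<noteq> j \<Longrightarrow> input_matrix i j = Lin (indicator {(i, j)})"
  by (simp_all add: input_matrix_def)

text \<open>Distinctness of the columns makes all compared forms formally different, so that every
  comparison of finite entries is recorded.\<close>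

lemma fold_min_step_row:
  assumes "(i, j) \<in> arcs n" and "j \<notin> set ks" and "distinct ks" and "set ks \<subseteq> {1..n}"
  shows "snd (fold (min_step n C) (map (input_matrix i) ks) (Lin (indicator {(i, j)}), h))
    = h @ scan C i j (removeAll i ks)"
  using assms
proof (induction ks arbitrary: j h)
  case (Cons k ks)
  show ?case
  proof (cases "k = i")
    case True
    then show ?thesis using Cons by (simp add: input_matrix_simps min_step_simps)
  next
    case False
    then have ik: "(i, k) \<in> arcs n" using Cons.prems by (auto simp: arcs_def)
    define m where "m = (if C (i, j) > C (i, k) then k else j)"
    have "min_step n C (input_matrix i k) (Lin (indicator {(i, j)}), h)
        = (Lin (indicator {(i, m)}), h @ [C (i, j) > C (i, k)])"
      using test_gt_arcs[OF Cons.prems(1) ik] Cons.prems(2) False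
      by (simp add: input_matrix_def min_step_def m_def del: test_gt.simps)
    moreover have "(i, m) \<in> arcs n" "m \<notin> set ks"
      using ik Cons.prems by (simp_all add: m_def)
    ultimately show ?thesis
      using Cons.IH[of m] Cons.prems(3,4) False by (simp add: m_def[symmetric])
  qed
qed simp

lemma find_min_row:
  assumes "i \<in> {1..n}" and "distinct J" and "set J \<subseteq> {1..n}"
  shows "snd (find_min n C (map (input_matrix i) J) h) = h @ row_tests C J i"
  unfolding find_min_fold using assms
proof (induction J)
  case (Cons j J)
  show ?case
  proof (cases "j = i")
    case True
    then show ?thesis
      using Cons by (simp add: input_matrix_simps min_step_simps row_tests_def)
  next
    case False
    then have "(i, j) \<in> arcs n" using Cons.prems by (auto simp: arcs_def)
    then show ?thesis
      using Cons.prems False fold_min_step_row[of i j n J C h]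
      by (simp add: input_matrix_simps min_step_simps row_tests_def)
  qed
qed (simp add: row_tests_def)

text \<open>Reducing a row changes no other row, so each row is still in its input form when its
  turn comes.\<close>

lemma fold_reduce_row_history:
  assumes "distinct J" and "set J \<subseteq> {1..n}" and "distinct is" and "set is \<subseteq> {1..n}"
    and "\<forall>i\<in>set is. M i = input_matrix i"
  shows "snd (snd (fold (reduce_row n C J) is (M, s, h))) = h @ concat (map (row_tests C J) is)"
  using assms(3-)
proof (induction "is" arbitrary: M s h)
  case (Cons i "is")
  obtain M' s' h' where 1: "reduce_row n C J i (M, s, h) = (M', s', h')" by (metis prod_cases3)
  have "M i = input_matrix i" "i \<in> {1..n}" using Cons.prems by simp_all
  then have h': "h' = h @ row_tests C J i"
    using 1 find_min_row[of i n J C h] assms(1,2) by (simp add: reduce_row_eq)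
  have "M' k = input_matrix k" if "k \<in> set is" for k
  proof -
    have "k \<noteq> i" "M k = input_matrix k" using Cons.prems that by auto
    then show ?thesis using 1 by (auto simp: reduce_row_eq)
  qed
  then have "snd (snd (fold (reduce_row n C J) is (M', s', h'))) = h' @ concat (map (row_tests C J) is)"
    using Cons.prems by (intro Cons.IH) auto
  then show ?case by (simp add: 1 h')
qed simp

lemma prefix_row_tests_history:
  assumes "[1..<Suc n] = is @ is'"
  shows "prefix (concat (map (row_tests C [1..<Suc n]) is)) (history_of n C)"
proof -
  let ?V = "[1..<Suc n]"
  have d: "distinct is" "set is \<subseteq> {1..n}"
  proof -
    have "distinct (is @ is')" "set (is @ is') = {1..n}"
      unfolding assms[symmetric] by auto
    then show "distinct is" "set is \<subseteq> {1..n}" by auto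
  qed
  have "snd (snd (fold (reduce_row n C ?V) is (input_matrix, Lin 0, [])))
      = [] @ concat (map (row_tests C ?V) is)"
    using d by (intro fold_reduce_row_history) auto
  then have "prefix (concat (map (row_tests C ?V) is))
      (snd (snd (reduction n C ?V ?V input_matrix (Lin 0) [])))"
    using prefix_rows_cols[of n C ?V "is" "(input_matrix, Lin 0, [])" ?V ?V is']
    by (simp add: reduction_def assms[symmetric] del: upt_Suc)
  then show ?thesis
    unfolding history_of_def run_def
    using prefix_reduction_branch_bound by (rule prefix_order.trans)
qed


section \<open>Optimality and adjacency for n = 5 by finite enumeration\<close>

section \<open>Circuits on five vertices\<close>

definition tour_vector :: "nat list \<Rightarrow> arc \<Rightarrow> int" where
  "tour_vector vs = indicator (circuit vs)"

definition tour_cost :: "(arc \<Rightarrow> int) \<Rightarrow> nat list \<Rightarrow> int" where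
  "tour_cost C vs = (\<Sum>a\<leftarrow>zip vs (rotate1 vs). C a)"

text \<open>Circuits are normalised by rotation to start at 1. With \<open>tour_cost\<close> as a
  list sum, claims about all 24 of them can be settled by evaluation.\<close>

definition five_tours :: "nat list list" where
  "five_tours = map ((#) 1) (filter distinct (List.n_lists 4 [2, 3, 4, 5]))"

lemma circuit_append_commute: "circuit (p @ q) = circuit (q @ p)"
proof (cases "p = [] \<or> q = []")
  case False
  then show ?thesis by (auto simp: circuit_eq_path path_arcs_append)
qed auto

lemma set_five_tours:
  "set five_tours = {1 # ws | ws. distinct (1 # ws) \<and> set (1 # ws) = {1..5}}"
proof -
  have V: "{1..5::nat} = {1, 2, 3, 4, 5}" by auto
  have "ws \<in> set (filter distinct (List.n_lists 4 [2, 3, 4, 5])) \<longleftrightarrow>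
      distinct (1 # ws) \<and> set (1 # ws) = {1..5}" for ws :: "nat list"
  proof
    assume "ws \<in> set (filter distinct (List.n_lists 4 [2, 3, 4, 5]))"
    then have ws: "distinct ws" "length ws = 4" "set ws \<subseteq> {2, 3, 4, 5}"
      by (auto simp: set_n_lists)
    then have "set ws = {2, 3, 4, 5}"
      by (intro card_subset_eq) (simp_all add: distinct_card)
    then show "distinct (1 # ws) \<and> set (1 # ws) = {1..5}"
      using ws unfolding V by simp
  next
    assume ws: "distinct (1 # ws) \<and> set (1 # ws) = {1..5}"
    then have "length (1 # ws) = card {1..5::nat}" by (metis distinct_card)
    moreover have "set ws = {1, 2, 3, 4, 5} - {1}" using ws unfolding V by (metis Diff_insert_absorb distinct.simps(2) list.simps(15))
    ultimately show "ws \<in> set (filter distinct (List.n_lists 4 [2, 3, 4, 5]))"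
      using ws by (auto simp: set_n_lists)
  qed
  then show ?thesis by (auto simp: five_tours_def)
qed

lemma hamiltonian_circuit_five: "hamiltonian_circuit 5 H \<longleftrightarrow> (\<exists>vs\<in>set five_tours. H = circuit vs)"
proof
  assume "hamiltonian_circuit 5 H"
  then obtain vs where vs: "distinct vs" "set vs = {1..5}" "H = circuit vs"
    by (auto simp: hamiltonian_circuit_iff)
  then have "1 \<in> set vs" by simp
  then obtain p q where pq: "vs = p @ 1 # q" by (meson split_list)
  then have "distinct (1 # q @ p)" "set (1 # q @ p) = {1..5}" using vs by auto
  then have "1 # q @ p \<in> set five_tours" unfolding set_five_tours by blast
  moreover have "H = circuit (1 # q @ p)"
    using circuit_append_commute[of p "1 # q"] by (simp add: vs pq)
  ultimately show "\<exists>vs\<in>set five_tours. H = circuit vs" by blast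
next
  assume "\<exists>vs\<in>set five_tours. H = circuit vs"
  then show "hamiltonian_circuit 5 H"
    unfolding set_five_tours hamiltonian_circuit_iff by blast
qed

lemma solutions_five: "solutions 5 = tour_vector ` set five_tours"
  by (auto simp: solutions_def hamiltonian_circuit_five tour_vector_def)

lemma inner_tour_vector:
  assumes "vs \<in> set five_tours"
  shows "inner 5 (tour_vector vs) C = tour_cost C vs"
proof -
  have "hamiltonian_circuit 5 (circuit vs)" "distinct vs"
    using assms hamiltonian_circuit_five by (blast, auto simp: set_five_tours)
  then show ?thesis
    using inner_tour[of 5 "circuit vs" C]
    by (simp add: tour_vector_def tour_cost_def circuit_def distinct_zipI1 sum.distinct_set_conv_list)
qed

lemma optimal_five_iff:
  assumes "v \<in> set five_tours"
  shows "optimal 5 C (tour_vector v) \<longleftrightarrow> (\<forall>w\<in>set five_tours. tour_cost C v \<le> tour_cost C w)"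
  using assms by (auto simp: optimal_def solutions_five inner_tour_vector)

lemma optimal_five_set:
  assumes "set V \<subseteq> set five_tours" and "V \<noteq> []" and "\<forall>v\<in>set V. tour_cost C v = m"
    and "\<forall>w\<in>set five_tours. w \<in> set V \<or> m < tour_cost C w"
  shows "{z. optimal 5 C z} = tour_vector ` set V"
proof (intro equalityI subsetI)
  fix z assume z: "z \<in> {z. optimal 5 C z}"
  then obtain v where v: "v \<in> set five_tours" "z = tour_vector v"
    by (auto simp: optimal_def solutions_five)
  have "hd V \<in> set V" using assms(2) by simp
  then have "tour_cost C v \<le> m"
    using z v optimal_five_iff[of v C] assms(1,3) by auto
  then show "z \<in> tour_vector ` set V" using v assms(4) by force
next
  fix z assume "z \<in> tour_vector ` set V"
  then obtain v where v: "v \<in> set V" "z = tour_vector v" by blast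
  moreover have "m \<le> tour_cost C w" if "w \<in> set five_tours" for w
    using assms(3,4) that by force
  ultimately show "z \<in> {z. optimal 5 C z}"
    using optimal_five_iff[of v C] assms(1,3) by auto
qed

text \<open>Two circuits are adjacent as soon as their union contains no third one.\<close>

definition penalty :: "nat list \<Rightarrow> nat list \<Rightarrow> arc \<Rightarrow> int" where
  "penalty v w a = (if a \<in> set (zip v (rotate1 v) @ zip w (rotate1 w)) then 0 else 1)"

text \<open>An executable criterion: only the two given circuits have penalty zero. The failed
  inclusion makes them different as arc sets.\<close>

definition only_circuits_in_union :: "nat list \<Rightarrow> nat list \<Rightarrow> bool" where
  "only_circuits_in_union v w \<longleftrightarrow> v \<in> set five_tours \<and> w \<in> set five_tours \<and>
     \<not> set (zip v (rotate1 v)) \<subseteq> set (zip w (rotate1 w)) \<and>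
     tour_cost (penalty v w) v = 0 \<and> tour_cost (penalty v w) w = 0 \<and>
     (\<forall>u\<in>set five_tours. u = v \<or> u = w \<or> 0 < tour_cost (penalty v w) u)"

lemma only_circuits_in_union_adjacent:
  assumes "only_circuits_in_union v w"
  shows "adjacent 5 (tour_vector v) (tour_vector w)"
proof -
  have "{z. optimal 5 (penalty v w) z} = tour_vector ` set [v, w]"
    using assms by (intro optimal_five_set[where m = 0]) (auto simp: only_circuits_in_union_def)
  moreover have "tour_vector v \<noteq> tour_vector w"
    using assms by (auto simp: only_circuits_in_union_def tour_vector_def indicator_int_eq_iff circuit_def)
  ultimately show ?thesis
    using assms unfolding adjacent_def only_circuits_in_union_def solutions_five by auto
qed

lemma adjacent_sym: "adjacent n x y \<Longrightarrow> adjacent n y x"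
  by (auto simp: adjacent_def insert_commute)


section \<open>The node, its four lost circuits and the clique\<close>

section \<open>The critical node\<close>

text \<open>Three outcomes for each of rows 1, 2 and 3, then the first of row 4; the next test is
  c42 > c43.\<close>

definition node :: history where
  "node = [True, True, True, True, False, False, True, False, False, True]"

definition at_node :: "(arc \<Rightarrow> int) \<Rightarrow> bool" where
  "at_node C \<longleftrightarrow> C (1, 5) < C (1, 4) \<and> C (1, 4) < C (1, 3) \<and> C (1, 3) < C (1, 2) \<and>
     C (2, 3) < C (2, 1) \<and> C (2, 3) \<le> C (2, 4) \<and> C (2, 3) \<le> C (2, 5) \<and>
     C (3, 2) < C (3, 1) \<and> C (3, 2) \<le> C (3, 4) \<and> C (3, 2) \<le> C (3, 5) \<and>
     C (4, 2) < C (4, 1)"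

lemma prefix_node_iff:
  "prefix (node @ [b]) (history_of 5 C) \<longleftrightarrow> at_node C \<and> (C (4, 3) < C (4, 2)) = b"
proof -
  \<comment> \<open>Rows 1 to 4 record twelve outcomes, enough to cover the node and its own
    test.\<close>
  have V: "[1..<Suc 5] = [1, 2, 3, 4] @ [5]" by (simp add: upt_rec)
  obtain rest where "history_of 5 C = concat (map (row_tests C [1..<Suc 5]) [1, 2, 3, 4]) @ rest"
    using prefix_row_tests_history[OF V, of C] by (auto elim: prefixE)
  then show ?thesis
    unfolding V by (auto simp: row_tests_def node_def at_node_def split: if_splits)
qed

text \<open>Vertices count from 1, list positions from 0. The diagonal entries of the matrices below
  are fillers: no circuit contains a diagonal arc.\<close>

definition matrix_cost :: "int list list \<Rightarrow> arc \<Rightarrow> int" where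
  "matrix_cost rows a = rows ! (fst a - 1) ! (snd a - 1)"

definition unique_optimum :: "(arc \<Rightarrow> int) \<Rightarrow> nat list \<Rightarrow> bool" where
  "unique_optimum C v \<longleftrightarrow> v \<in> set five_tours \<and>
     (\<forall>w\<in>set five_tours. w = v \<or> tour_cost C v < tour_cost C w)"

lemma unique_optimum_output:
  assumes "unique_optimum C v"
  shows "algorithm_output 5 C = tour_vector v"
proof -
  have "{z. optimal 5 C z} = tour_vector ` set [v]"
    using assms by (intro optimal_five_set) (auto simp: unique_optimum_def)
  then show ?thesis using algorithm_output_optimal[of 5 C] by auto
qed

lemma output_le:
  assumes "algorithm_output 5 C = tour_vector v" and "v \<in> set five_tours" and "w \<in> set five_tours"
  shows "tour_cost C v \<le> tour_cost C w"
  using algorithm_output_optimal[of 5 C] assms optimal_five_iff by fastforce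

text \<open>The input \<open>C\<close> realises \<open>v\<close> behind the positive edge; behind
  the negative edge \<open>w\<close> is always strictly shorter, so an optimal output is never
  \<open>v\<close>.\<close>

lemma in_R_minus:
  assumes "unique_optimum C v" and "at_node C" and "C (4, 3) < C (4, 2)"
    and w: "w \<in> set five_tours"
    and dom: "\<And>D. at_node D \<Longrightarrow> D (4, 2) \<le> D (4, 3) \<Longrightarrow> tour_cost D w < tour_cost D v"
  shows "tour_vector v \<in> R_minus 5 node"
proof -
  have "prefix (node @ [True]) (history_of 5 C)"
    using assms(2,3) by (simp add: prefix_node_iff)
  then have "tour_vector v \<in> X_plus 5 node"
    unfolding X_plus_def using unique_optimum_output[OF assms(1)] by force
  moreover have "tour_vector v \<notin> X_minus 5 node"
  proof
    assume "tour_vector v \<in> X_minus 5 node"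
    then obtain D where D: "algorithm_output 5 D = tour_vector v" "prefix (node @ [False]) (history_of 5 D)"
      unfolding X_minus_def by force
    then have "tour_cost D w < tour_cost D v"
      using dom by (simp add: prefix_node_iff not_less)
    then show False
      using output_le[OF D(1) _ w] assms(1) by (simp add: unique_optimum_def)
  qed
  ultimately show ?thesis by (simp add: R_minus_def)
qed

text \<open>The mirror image of \<open>in_R_minus\<close>, with the domination now on the positive
  edge.\<close>

lemma in_R_plus:
  assumes "unique_optimum C v" and "at_node C" and "C (4, 2) \<le> C (4, 3)"
    and w: "w \<in> set five_tours"
    and dom: "\<And>D. at_node D \<Longrightarrow> D (4, 3) < D (4, 2) \<Longrightarrow> tour_cost D w < tour_cost D v"
  shows "tour_vector v \<in> R_plus 5 node"
proof -
  have "prefix (node @ [False]) (history_of 5 C)"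
    using assms(2,3) by (simp add: prefix_node_iff not_less)
  then have "tour_vector v \<in> X_minus 5 node"
    unfolding X_minus_def using unique_optimum_output[OF assms(1)] by force
  moreover have "tour_vector v \<notin> X_plus 5 node"
  proof
    assume "tour_vector v \<in> X_plus 5 node"
    then obtain D where D: "algorithm_output 5 D = tour_vector v" "prefix (node @ [True]) (history_of 5 D)"
      unfolding X_plus_def by force
    then have "tour_cost D w < tour_cost D v"
      using dom by (simp add: prefix_node_iff)
    then show False
      using output_le[OF D(1) _ w] assms(1) by (simp add: unique_optimum_def)
  qed
  ultimately show ?thesis by (simp add: R_plus_def)
qed

lemma two_R_minus:
  "tour_vector [1, 2, 4, 3, 5] \<in> R_minus 5 node"
  "tour_vector [1, 2, 5, 4, 3] \<in> R_minus 5 node"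
proof -
  \<comment> \<open>The competitor 14235 shares (3,5) and (5,1); the other arcs compare by c14 <
    c12, c23 \<le> c24 and c42 \<le> c43. In \<open>?C\<close> the circuit pays only 3, for
    (1,2).\<close>
  let ?C = "matrix_cost [[0,3,2,1,0], [1,0,0,0,3], [1,0,0,0,0], [4,3,0,0,2], [0,3,0,3,0]]"
  show "tour_vector [1, 2, 4, 3, 5] \<in> R_minus 5 node"
  proof (rule in_R_minus[where C = ?C and w = "[1, 4, 2, 3, 5]"])
    show "unique_optimum ?C [1, 2, 4, 3, 5]" by code_simp
    show "[1, 4, 2, 3, 5] \<in> set five_tours" by code_simp
  qed (auto simp: at_node_def matrix_cost_def tour_cost_def)
  \<comment> \<open>The competitor 15423 shares (5,4) and (3,1); c15 < c12, c23 \<le> c25 and c42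
    \<le> c43 decide. The node forces (3,1) to cost more than (3,2), hence the 1 there; the circuit
    costs 4.\<close>
  let ?D = "matrix_cost [[0,3,2,1,0], [5,0,0,0,0], [1,0,0,0,0], [5,4,0,0,0], [4,4,1,0,0]]"
  show "tour_vector [1, 2, 5, 4, 3] \<in> R_minus 5 node"
  proof (rule in_R_minus[where C = ?D and w = "[1, 5, 4, 2, 3]"])
    show "unique_optimum ?D [1, 2, 5, 4, 3]" by code_simp
    show "[1, 5, 4, 2, 3] \<in> set five_tours" by code_simp
  qed (auto simp: at_node_def matrix_cost_def tour_cost_def)
qed

lemma two_R_plus:
  "tour_vector [1, 3, 4, 2, 5] \<in> R_plus 5 node"
  "tour_vector [1, 3, 5, 4, 2] \<in> R_plus 5 node"
proof -
  \<comment> \<open>The competitor 14325 shares (2,5) and (5,1); c14 < c13, c32 \<le> c34 and c43 <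
    c42 decide. In \<open>?C\<close> the circuit pays only 2, for (1,3).\<close>
  let ?C = "matrix_cost [[0,3,2,1,0], [1,0,0,0,0], [1,0,0,0,2], [1,0,2,0,1], [0,2,2,2,0]]"
  show "tour_vector [1, 3, 4, 2, 5] \<in> R_plus 5 node"
  proof (rule in_R_plus[where C = ?C and w = "[1, 4, 3, 2, 5]"])
    show "unique_optimum ?C [1, 3, 4, 2, 5]" by code_simp
    show "[1, 4, 3, 2, 5] \<in> set five_tours" by code_simp
  qed (auto simp: at_node_def matrix_cost_def tour_cost_def)
  \<comment> \<open>The competitor 15432 shares (5,4) and (2,1); c15 < c13, c32 \<le> c35 and c43 <
    c42 decide. The node forces (2,1) to cost more than (2,3), hence the 1 there; the circuit costs
    3.\<close>
  let ?D = "matrix_cost [[0,3,2,1,0], [1,0,0,0,1], [4,0,0,0,0], [1,0,3,0,0], [3,3,3,0,0]]"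
  show "tour_vector [1, 3, 5, 4, 2] \<in> R_plus 5 node"
  proof (rule in_R_plus[where C = ?D and w = "[1, 5, 4, 3, 2]"])
    show "unique_optimum ?D [1, 3, 5, 4, 2]" by code_simp
    show "[1, 5, 4, 3, 2] \<in> set five_tours" by code_simp
  qed (auto simp: at_node_def matrix_cost_def tour_cost_def)
qed

lemma node_internal: "node \<in> internal_nodes 5"
proof -
  obtain C where "prefix (node @ [True]) (history_of 5 C)"
    using two_R_minus(1) by (auto simp: R_minus_def X_plus_def)
  then show ?thesis
    unfolding internal_nodes_def by (blast intro: strict_prefixI' prefix_snocD)
qed

lemma four_tours_adjacent:
  "adjacent 5 (tour_vector [1, 2, 4, 3, 5]) (tour_vector [1, 2, 5, 4, 3])"
  "adjacent 5 (tour_vector [1, 2, 4, 3, 5]) (tour_vector [1, 3, 4, 2, 5])"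
  "adjacent 5 (tour_vector [1, 2, 4, 3, 5]) (tour_vector [1, 3, 5, 4, 2])"
  "adjacent 5 (tour_vector [1, 2, 5, 4, 3]) (tour_vector [1, 3, 4, 2, 5])"
  "adjacent 5 (tour_vector [1, 2, 5, 4, 3]) (tour_vector [1, 3, 5, 4, 2])"
  "adjacent 5 (tour_vector [1, 3, 4, 2, 5]) (tour_vector [1, 3, 5, 4, 2])"
  by (rule only_circuits_in_union_adjacent, code_simp)+

text \<open>Finiteness of \<open>Y\<close> matters because \<open>card\<close> is 0 on infinite
  sets.\<close>

lemma card_Int_ge_2:
  assumes "finite Y" and "x \<noteq> y" and "{x, y} \<subseteq> R \<inter> Y"
  shows "2 \<le> card (R \<inter> Y)"
  using card_mono[of "R \<inter> Y" "{x, y}"] assms by simp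

theorem mainTheorem1:
  shows "\<not> direct_type_algorithm \<and>
    (\<exists>n\<ge>3. \<exists>B\<in>internal_nodes n. \<exists>Y. clique n Y \<and>
       min (card (R_plus n B \<inter> Y)) (card (R_minus n B \<inter> Y)) \<ge> 2)"
proof -
  let ?Y = "tour_vector ` {[1, 2, 4, 3, 5], [1, 2, 5, 4, 3], [1, 3, 4, 2, 5], [1, 3, 5, 4, 2]}"
  note adj = four_tours_adjacent four_tours_adjacent[THEN adjacent_sym]
  have ne: "x \<noteq> y" "x \<in> solutions 5" if "adjacent 5 x y" for x y
    using that by (simp_all add: adjacent_def)
  \<comment> \<open>Facts 1, 4, 6 and 12 of \<open>adj\<close> have the four tours as first
    arguments, one each, which puts them into \<open>solutions 5\<close>; the symmetric copies cover
    all ordered pairs.\<close>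
  have "clique 5 ?Y"
    unfolding clique_def using adj ne(2)[OF adj(1)] ne(2)[OF adj(4)] ne(2)[OF adj(6)] ne(2)[OF adj(12)]
    by auto
  moreover have "2 \<le> card (R_minus 5 node \<inter> ?Y)"
    using two_R_minus ne(1)[OF adj(1)] by (intro card_Int_ge_2) auto
  moreover have "2 \<le> card (R_plus 5 node \<inter> ?Y)"
    using two_R_plus ne(1)[OF adj(6)] by (intro card_Int_ge_2) auto
  ultimately have main: "\<exists>n\<ge>3. \<exists>B\<in>internal_nodes n. \<exists>Y. clique n Y \<and>
      min (card (R_plus n B \<inter> Y)) (card (R_minus n B \<inter> Y)) \<ge> 2"
    using node_internal by (intro exI[of _ 5] conjI bexI[of _ node] exI[of _ ?Y]) simp_all
  then have "\<not> direct_type_algorithm"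
    unfolding direct_type_algorithm_def direct_type_tree_def by force
  with main show ?thesis by blast
qed

end
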